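(* For each $n$ let $N=\binom n2$, let $\alpha=(\alpha_e)_{e\in E_n}$ be $M$-bounded with $M=M(n)$, and let $G_{\Sigma,p}$ be the random graph on $[n]$ defined by a uniform random point of the simplex $\Sigma=\{X\in\mathbb{R}_+^N:\sum_{e\in E_n}\alpha_eX_e\le N\}$. Let $\varepsilon>0$ be a small positive constant. (a) If $p\le\frac{1-\varepsilon}{Mn}$, then with high probability the maximum component size in $G_{\Sigma,p}$ is $O(\ln n)$. (b) If $p\ge\frac{(1+\varepsilon)M}{n}$, then with high probability there is a unique giant component in $G_{\Sigma,p}$, of size at least $\kappa n$, where $\kappa=\kappa(\varepsilon,M)>0$.
   Context: $[n]=\{1,\dots,n\}$ and $E_n=\binom{[n]}{2}$ is the set of unordered pairs of vertices, so $|E_n|=N$. The vector $\alpha$ is $M$-bounded if $1/M\le\alpha_e\le M$ for all $e\in E_n$. Choose $X$ uniformly at random from $\Sigma$; $G_{\Sigma,p}$ is the graph with vertex set $[n]$ whose edges are the pairs $e$ with $X_e\le p$. The size of a component is its number of vertices; a giant component is one of size linear in $n$. "With high probability" means with probability tending to $1$ as $n\to\infty$. *)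

theory Defs
  imports "HOL-Probability.Probability"
begin

definition pairs :: "nat \<Rightarrow> nat set set" where
  "pairs n = {e. e \<subseteq> {1..n} \<and> card e = 2}"

text \<open>The conjunct \<open>0 < M\<close> is implicit in writing \<open>1 / M\<close>; without it, the convention
  \<open>1 / 0 = 0\<close> (and negative \<open>M\<close>) would admit nonpositive weights.\<close>

definition M_bounded :: "nat \<Rightarrow> real \<Rightarrow> (nat set \<Rightarrow> real) \<Rightarrow> bool" where
  "M_bounded n M \<alpha> \<longleftrightarrow> 0 < M \<and> (\<forall>e\<in>pairs n. 1 / M \<le> \<alpha> e \<and> \<alpha> e \<le> M)"

text \<open>Points of \<open>\<real>\<^sup>N\<close>, with coordinates indexed by \<open>pairs n\<close>, are the extensional functions on
  \<open>pairs n\<close>, i.e. the space of the product measure \<open>Pi\<^sub>M (pairs n) (\<lambda>_. lborel)\<close>.\<close>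

definition weighted_simplex :: "nat \<Rightarrow> (nat set \<Rightarrow> real) \<Rightarrow> (nat set \<Rightarrow> real) set" where
  "weighted_simplex n \<alpha> =
     {X \<in> pairs n \<rightarrow>\<^sub>E {0..}. (\<Sum>e\<in>pairs n. \<alpha> e * X e) \<le> real (n choose 2)}"

definition unif_simplex :: "nat \<Rightarrow> (nat set \<Rightarrow> real) \<Rightarrow> (nat set \<Rightarrow> real) measure" where
  "unif_simplex n \<alpha> = uniform_measure (Pi\<^sub>M (pairs n) (\<lambda>_. lborel)) (weighted_simplex n \<alpha>)"

text \<open>A graph on the vertex set \<open>{1..n}\<close> is given by its set of edges, a subset of \<open>pairs n\<close>.\<close>

definition threshold_graph :: "nat \<Rightarrow> real \<Rightarrow> (nat set \<Rightarrow> real) \<Rightarrow> nat set set" where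
  "threshold_graph n p X = {e \<in> pairs n. X e \<le> p}"

definition components :: "nat \<Rightarrow> nat set set \<Rightarrow> nat set set" where
  "components n F = {1..n} // {(u, v). {u, v} \<in> F}\<^sup>*"

definition max_component_size :: "nat \<Rightarrow> nat set set \<Rightarrow> nat" where
  "max_component_size n F = Max (card ` components n F)"

text \<open>\<open>K\<close> is the only component whose size is at least the linear threshold \<open>c * n\<close>.\<close>

definition unique_giant :: "real \<Rightarrow> nat \<Rightarrow> nat set set \<Rightarrow> nat set \<Rightarrow> bool" where
  "unique_giant c n F K \<longleftrightarrow>
     K \<in> components n F \<and> c * real n \<le> real (card K) \<and>
     (\<forall>L\<in>components n F. c * real n \<le> real (card L) \<longrightarrow> L = K)"

definition whp :: "(nat \<Rightarrow> 'a measure) \<Rightarrow> (nat \<Rightarrow> 'a \<Rightarrow> bool) \<Rightarrow> bool" where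
  "whp \<mu> P \<longleftrightarrow> (\<lambda>n. \<P>(x in \<mu> n. P n x)) \<longlonglongrightarrow> 1"

end

theory Submission
  imports Defs "HOL-Real_Asymp.Real_Asymp"
begin

text \<open>Prescribing which of the pairs in a set \<open>Z\<close> are edges cuts out of the simplex a region whose volume,
  as a function of the budget, can be controlled. By translation, forbidding one more pair \<open>e\<close> lowers the
  budget from \<open>N\<close> to \<open>N - \<alpha> e * p\<close>. The \<open>N - |Z|\<close> unconstrained coordinates force the volume to
  drop by a factor of at most \<open>exp (- \<alpha> e * p * (N - |Z|) / N)\<close>, and star-shapedness of the region bounds the
  drop in the other direction. So, as long as few pairs have been exposed, every further pair is an edge with
  conditional probability at least \<open>(1 + \<epsilon> / 2) / n\<close> in (b) and at most \<open>(1 - \<epsilon> / 2) / n\<close> in (a), despite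
  the dependence between the pairs.

  This is all that a breadth-first exploration needs. In (a), a Chernoff bound shows that the exploration
  of a component dies after \<open>O (ln n)\<close> steps. In (b), after \<open>t = \<delta> n\<close> steps the number of active vertices
  is at least \<open>\<epsilon> t / 8\<close>, up to an exponentially small probability, wherever the exploration starts. With
  restarts allowed, the active vertices all lie in one component, which gives existence. For uniqueness, two
  components with more than \<open>t\<close> vertices would be explored one after the other for \<open>t\<close> steps each,
  leaving two linear sets of active vertices and a quadratic number of unexposed pairs between them, all of which
  would have to be non-edges; there are only \<open>n\<^sup>2\<close> choices of starting points.\<close>

section \<open>Volumes of slices\<close>

text \<open>The budget \<open>b\<close> stays a free argument because integrating out a coordinate
  \<open>e\<close> replaces it by \<open>b - a e * y\<close>; most of the volume estimates are
  inductions on \<open>I\<close> along this recursion.\<close>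

definition slice_vol :: "('i \<Rightarrow> real) \<Rightarrow> ('i \<Rightarrow> real set) \<Rightarrow> 'i set \<Rightarrow> real \<Rightarrow> ennreal" where
  "slice_vol a J I b =
     emeasure (Pi\<^sub>M I (\<lambda>_. lborel)) {x \<in> Pi\<^sub>E I J. (\<Sum>i\<in>I. a i * x i) \<le> b}"

lemma slice_sets:
  fixes a :: "'i \<Rightarrow> real"
  assumes "finite I" "\<And>i. i \<in> I \<Longrightarrow> J i \<in> sets borel"
  shows "{x \<in> Pi\<^sub>E I J. (\<Sum>i\<in>I. a i * x i) \<le> b} \<in> sets (Pi\<^sub>M I (\<lambda>_. lborel))"
proof -
  have "{x \<in> Pi\<^sub>E I J. (\<Sum>i\<in>I. a i * x i) \<le> b} =
     Pi\<^sub>E I J \<inter> {x \<in> space (Pi\<^sub>M I (\<lambda>_. lborel)). (\<Sum>i\<in>I. a i * x i) \<le> b}"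
    by (auto simp: space_PiM PiE_def)
  moreover have "Pi\<^sub>E I J \<in> sets (Pi\<^sub>M I (\<lambda>_. lborel))"
    using assms by (intro sets_PiM_I_finite) auto
  moreover have "(\<lambda>x. \<Sum>i\<in>I. a i * x i) \<in> borel_measurable (Pi\<^sub>M I (\<lambda>_. lborel))"
  proof (rule borel_measurable_sum)
    fix i assume "i \<in> I"
    then have "(\<lambda>x. x i) \<in> borel_measurable (Pi\<^sub>M I (\<lambda>_. lborel :: real measure))"
      using measurable_component_singleton[of i I "\<lambda>_. lborel :: real measure"] by simp
    then show "(\<lambda>x. a i * x i) \<in> borel_measurable (Pi\<^sub>M I (\<lambda>_. lborel :: real measure))"
      by (intro borel_measurable_times[OF borel_measurable_const])
  qed
  then have "{x \<in> space (Pi\<^sub>M I (\<lambda>_. lborel)). (\<Sum>i\<in>I. a i * x i) \<le> b} \<in> sets (Pi\<^sub>M I (\<lambda>_. lborel))"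
    by measurable
  ultimately show ?thesis by auto
qed

lemma slice_vol_empty: "slice_vol a J {} b = indicator {0..} b"
  by (auto simp: slice_vol_def PiM_empty indicator_def)

text \<open>Tonelli, with coordinate \<open>e\<close> as the outermost integral.\<close>

lemma slice_vol_insert:
  assumes "finite I" "e \<notin> I" "\<And>i. i \<in> insert e I \<Longrightarrow> J i \<in> sets borel"
  shows "slice_vol a J (insert e I) b =
     (\<integral>\<^sup>+y. indicator (J e) y * slice_vol a J I (b - a e * y) \<partial>lborel)"
proof -
  interpret product_sigma_finite "\<lambda>_. lborel :: real measure"
    by unfold_locales
  let ?S = "\<lambda>I b. {x \<in> Pi\<^sub>E I J. (\<Sum>i\<in>I. a i * x i) \<le> b}"
  have S: "?S (insert e I) b \<in> sets (Pi\<^sub>M (insert e I) (\<lambda>_. lborel))"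
    using assms by (intro slice_sets) auto
  have "slice_vol a J (insert e I) b =
    (\<integral>\<^sup>+x. indicator (?S (insert e I) b) x \<partial>Pi\<^sub>M (insert e I) (\<lambda>_. lborel))"
    using S by (simp add: slice_vol_def)
  also have "\<dots> = (\<integral>\<^sup>+y. \<integral>\<^sup>+x. indicator (?S (insert e I) b) (x(e := y))
      \<partial>Pi\<^sub>M I (\<lambda>_. lborel) \<partial>lborel)"
    using assms S by (intro product_nn_integral_insert_rev) auto
  also have "\<dots> = (\<integral>\<^sup>+y. \<integral>\<^sup>+x. indicator (J e) y * indicator (?S I (b - a e * y)) x
      \<partial>Pi\<^sub>M I (\<lambda>_. lborel) \<partial>lborel)"
  proof (intro nn_integral_cong)
    fix y :: real and x assume x: "x \<in> space (Pi\<^sub>M I (\<lambda>_. lborel :: real measure))"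
    then have ext: "x \<in> extensional I" by (auto simp: space_PiM PiE_def)
    have "(\<Sum>i\<in>I. a i * (if i = e then y else x i)) = (\<Sum>i\<in>I. a i * x i)"
      using assms by (intro sum.cong) auto
    moreover have "x(e := y) \<in> Pi\<^sub>E (insert e I) J \<longleftrightarrow> y \<in> J e \<and> x \<in> Pi\<^sub>E I J"
      using ext assms(2) by (auto simp: PiE_def Pi_def extensional_def)
    ultimately show "indicator (?S (insert e I) b) (x(e := y)) =
        (indicator (J e) y * indicator (?S I (b - a e * y)) x :: ennreal)"
      using assms by (auto simp: indicator_def algebra_simps)
  qed
  also have "\<dots> = (\<integral>\<^sup>+y. indicator (J e) y * slice_vol a J I (b - a e * y) \<partial>lborel)"
    unfolding slice_vol_def using assms
    by (intro nn_integral_cong) (simp add: nn_integral_cmult slice_sets)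
  finally show ?thesis .
qed

lemma slice_vol_mono:
  assumes "finite I" "\<And>i. i \<in> I \<Longrightarrow> J i \<in> sets borel" "b \<le> c"
  shows "slice_vol a J I b \<le> slice_vol a J I c"
  unfolding slice_vol_def using assms by (intro emeasure_mono slice_sets) auto

text \<open>By monotonicity in the budget, every superlevel set is an interval.\<close>

lemma slice_vol_measurable:
  assumes "finite I" "\<And>i. i \<in> I \<Longrightarrow> J i \<in> sets borel"
  shows "slice_vol a J I \<in> borel_measurable borel"
proof (rule borel_measurableI_greater)
  fix c
  have "is_interval {x. c < slice_vol a J I x}"
    unfolding is_interval_1 using slice_vol_mono[OF assms] by (auto intro: less_le_trans)
  then show "{x \<in> space borel. c < slice_vol a J I x} \<in> sets borel"
    by (simp add: real_interval_borel_measurable)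
qed

lemma slice_vol_neg:
  assumes "\<And>i. i \<in> I \<Longrightarrow> J i \<subseteq> {0..}" "\<And>i. i \<in> I \<Longrightarrow> 0 \<le> a i" "b < 0"
  shows "slice_vol a J I b = 0"
proof -
  have "{x \<in> Pi\<^sub>E I J. (\<Sum>i\<in>I. a i * x i) \<le> b} = {}"
  proof (safe)
    fix x assume x: "x \<in> Pi\<^sub>E I J" "(\<Sum>i\<in>I. a i * x i) \<le> b"
    have "0 \<le> (\<Sum>i\<in>I. a i * x i)"
      using x(1) assms by (intro sum_nonneg mult_nonneg_nonneg) (auto simp: PiE_def Pi_def)
    with x(2) assms(3) show "x \<in> {}" by simp
  qed
  then show ?thesis by (simp add: slice_vol_def del: Collect_empty_eq)
qed

lemma slice_vol_finite:
  assumes "finite I" "\<And>i. i \<in> I \<Longrightarrow> J i \<in> sets borel"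
    and "\<And>i. i \<in> I \<Longrightarrow> J i \<subseteq> {0..}" "\<And>i. i \<in> I \<Longrightarrow> 0 < a i"
  shows "slice_vol a J I b < \<infinity>"
  using assms
proof (induction I arbitrary: b)
  case empty
  then show ?case by (auto simp: slice_vol_empty indicator_def)
next
  case (insert e I)
  have "slice_vol a J (insert e I) b =
     (\<integral>\<^sup>+y. indicator (J e) y * slice_vol a J I (b - a e * y) \<partial>lborel)"
    using insert by (intro slice_vol_insert) auto
  \<comment> \<open>For \<open>y\<close> beyond \<open>b / a e\<close> the remaining budget is
    negative and the slice is empty; below that, monotonicity bounds the slice by its value at
    budget \<open>b\<close>.\<close>
  also have "\<dots> \<le> (\<integral>\<^sup>+y. slice_vol a J I b * indicator {0..b / a e} y \<partial>lborel)"
  proof (intro nn_integral_mono)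
    fix y
    have ae: "0 < a e" using insert by simp
    show "indicator (J e) y * slice_vol a J I (b - a e * y) \<le> slice_vol a J I b * indicator {0..b / a e} y"
    proof (cases "y \<in> J e")
      case True
      then have y: "0 \<le> y" using insert.prems(2)[of e] by auto
      show ?thesis
      proof (cases "y \<le> b / a e")
        case True
        have "slice_vol a J I (b - a e * y) \<le> slice_vol a J I b"
          using insert y less_imp_le[OF ae] by (intro slice_vol_mono) auto
        then show ?thesis using True y by (auto simp: indicator_def)
      next
        case False
        then have "b - a e * y < 0" using ae by (simp add: field_simps)
        then have "slice_vol a J I (b - a e * y) = 0"
          using insert.prems by (intro slice_vol_neg) (auto intro: less_imp_le)
        then show ?thesis by simp
      qed
    qed simp
  qed
  also have "\<dots> = slice_vol a J I b * emeasure lborel {0..b / a e}"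
    by (simp add: nn_integral_cmult_indicator)
  also have "\<dots> < \<infinity>"
  proof -
    have "slice_vol a J I b < \<infinity>" by (rule insert.IH) (use insert.prems in auto)
    then show ?thesis
      by (cases "0 \<le> b / a e") (auto simp: ennreal_mult_less_top)
  qed
  finally show ?case .
qed

text \<open>The homothety with centre \<open>j\<close> and ratio \<open>r\<close> maps the region
  into itself, multiplies volumes by \<open>r ^ card I\<close> and scales the budget beyond the cost
  of \<open>j\<close> by \<open>r\<close>. Both ratios below 1 and ratios above 1 are used
  later.\<close>

lemma slice_vol_scale:
  assumes "finite I" "\<And>i. i \<in> I \<Longrightarrow> J i \<in> sets borel" "0 < r"
    and star: "\<And>i y. i \<in> I \<Longrightarrow> y \<in> J i \<Longrightarrow> j i + r * (y - j i) \<in> J i"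
  shows "ennreal (r ^ card I) * slice_vol a J I ((\<Sum>i\<in>I. a i * j i) + c)
       \<le> slice_vol a J I ((\<Sum>i\<in>I. a i * j i) + r * c)"
  using assms(1,2,4)
proof (induction I arbitrary: c)
  case empty
  show ?case using \<open>0 < r\<close> by (auto simp: slice_vol_empty indicator_def zero_le_mult_iff)
next
  case (insert e I)
  let ?s = "\<Sum>i\<in>I. a i * j i"
  have Je: "J e \<in> sets borel" and JI: "\<And>i. i \<in> I \<Longrightarrow> J i \<in> sets borel"
    using insert.prems by auto
  note meas = slice_vol_measurable[OF insert.hyps(1) JI, where a = a]
  have "slice_vol a J (insert e I) ((\<Sum>i\<in>insert e I. a i * j i) + r * c) =
     (\<integral>\<^sup>+y. indicator (J e) y * slice_vol a J I (?s + a e * j e + r * c - a e * y) \<partial>lborel)"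
    using insert by (subst slice_vol_insert) (auto simp: algebra_simps)
  \<comment> \<open>The homothety acts on the outer coordinate as a substitution. Its Jacobian
    supplies the factor \<open>r\<close> that is missing from \<open>r ^ card I\<close>.\<close>
  also have "\<dots> = ennreal r * (\<integral>\<^sup>+y. indicator (J e) (j e - r * j e + r * y) *
      slice_vol a J I (?s + a e * j e + r * c - a e * (j e - r * j e + r * y)) \<partial>lborel)"
    using \<open>0 < r\<close> Je meas
    by (subst nn_integral_real_affine[where c = r and t = "j e - r * j e"]) auto
  also have "\<dots> \<ge> ennreal r * (\<integral>\<^sup>+y. indicator (J e) y * (ennreal (r ^ card I) *
      slice_vol a J I (?s + (a e * j e + c - a e * y))) \<partial>lborel)"
  proof (intro mult_left_mono nn_integral_mono)
    fix y
    show "indicator (J e) y * (ennreal (r ^ card I) * slice_vol a J I (?s + (a e * j e + c - a e * y)))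
      \<le> indicator (J e) (j e - r * j e + r * y) *
         slice_vol a J I (?s + a e * j e + r * c - a e * (j e - r * j e + r * y))"
    proof (cases "y \<in> J e")
      case True
      then have "j e - r * j e + r * y \<in> J e"
        using insert.prems(2)[of e y] by (simp add: algebra_simps)
      moreover have "ennreal (r ^ card I) * slice_vol a J I (?s + (a e * j e + c - a e * y))
         \<le> slice_vol a J I (?s + r * (a e * j e + c - a e * y))"
        using insert.prems by (intro insert.IH) auto
      ultimately show ?thesis using True by (simp add: algebra_simps)
    qed simp
  qed simp
  also have "(\<integral>\<^sup>+y. indicator (J e) y * (ennreal (r ^ card I) *
      slice_vol a J I (?s + (a e * j e + c - a e * y))) \<partial>lborel)
     = (\<integral>\<^sup>+y. ennreal (r ^ card I) * (indicator (J e) y *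
      slice_vol a J I (?s + (a e * j e + c - a e * y))) \<partial>lborel)"
    by (simp add: mult_ac)
  also have "\<dots> = ennreal (r ^ card I) * (\<integral>\<^sup>+y. indicator (J e) y *
      slice_vol a J I (?s + (a e * j e + c - a e * y)) \<partial>lborel)"
    using Je meas by (intro nn_integral_cmult) auto
  also have "(\<integral>\<^sup>+y. indicator (J e) y * slice_vol a J I (?s + (a e * j e + c - a e * y)) \<partial>lborel)
     = slice_vol a J (insert e I) ((\<Sum>i\<in>insert e I. a i * j i) + c)"
    using insert by (subst slice_vol_insert) (auto simp: algebra_simps)
  finally show ?case
    using insert.hyps \<open>0 < r\<close> by (simp add: ennreal_mult mult.assoc)
qed

text \<open>The base case is the homogeneity of the volume of a simplex. Integrating out a restricted
  coordinate only lowers the remaining budget, so the factor for the full budget survives.\<close>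

lemma slice_vol_diff_le:
  assumes "finite I" "\<And>i. i \<in> I \<Longrightarrow> J i \<in> sets borel"
    and "\<And>i. i \<in> I \<Longrightarrow> J i \<subseteq> {0..}" "\<And>i. i \<in> I \<Longrightarrow> 0 < a i"
    and "finite U" "I \<inter> U = {}" "\<And>i. i \<in> U \<Longrightarrow> J i = {0..}" "\<And>i. i \<in> U \<Longrightarrow> 0 < a i"
    and "b \<le> B" "0 < B" "0 \<le> c"
  shows "slice_vol a J (I \<union> U) (b - c) \<le> ennreal (exp (- c / B) ^ card U) * slice_vol a J (I \<union> U) b"
  using assms(1-4,6,9)
proof (induction I arbitrary: b)
  case empty
  have neg: "slice_vol a J U b' = 0" if "b' < 0" for b'
    using that assms by (intro slice_vol_neg) (auto intro: less_imp_le)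
  show ?case
  proof (cases "0 < b")
    case True
    define r where "r = exp (- c / B)"
    have r: "0 < r" by (simp add: r_def)
    \<comment> \<open>From \<open>1 + x \<le> exp x\<close> and \<open>b \<le> B\<close>: lowering
      the budget by \<open>c\<close> is at least as severe as multiplying it by
      \<open>r\<close>.\<close>
    have "b - c = b * (1 + - c / b)" using True by (simp add: field_simps)
    also have "\<dots> \<le> b * exp (- c / b)" using True exp_ge_add_one_self[of "- c / b"] by simp
    also have "\<dots> \<le> b * r"
      unfolding r_def using True assms(10,11) empty by (intro mult_left_mono) (auto intro!: divide_left_mono)
    finally have le: "b - c \<le> b * r" .
    \<comment> \<open>The expanding homothety of ratio \<open>1 / r\<close> about the origin is
      admissible since every coordinate in \<open>U\<close> ranges over the whole half-line.\<close>
    have "ennreal ((1 / r) ^ card U) * slice_vol a J U ((\<Sum>i\<in>U. a i * 0) + b * r)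
        \<le> slice_vol a J U ((\<Sum>i\<in>U. a i * 0) + (1 / r) * (b * r))"
      using assms r by (intro slice_vol_scale) auto
    then have sc: "ennreal ((1 / r) ^ card U) * slice_vol a J U (b * r) \<le> slice_vol a J U b"
      using r by simp
    have "slice_vol a J U (b - c) \<le> slice_vol a J U (b * r)"
      using assms le by (intro slice_vol_mono) auto
    also have "\<dots> = ennreal (r ^ card U) * (ennreal ((1 / r) ^ card U) * slice_vol a J U (b * r))"
      using r by (simp add: mult.assoc[symmetric] ennreal_mult[symmetric] power_mult_distrib[symmetric])
    also have "\<dots> \<le> ennreal (r ^ card U) * slice_vol a J U b"
      using sc by (intro mult_left_mono) auto
    finally show ?thesis by (simp add: r_def)
  next
    case False
    show ?thesis
    proof (cases "c = 0")
      case True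
      then show ?thesis by simp
    next
      case c: False
      then show ?thesis using False assms(11) neg[of "b - c"] by simp
    qed
  qed
next
  case (insert e I)
  have fin: "finite (I \<union> U)" and e: "e \<notin> I \<union> U" and un: "insert e I \<union> U = insert e (I \<union> U)"
    using insert assms by auto
  have Jm: "J i \<in> sets borel" if "i \<in> insert e (I \<union> U)" for i
    using that insert.prems assms(7) by auto
  have ae: "0 < a e" using insert.prems by simp
  have IH: "slice_vol a J (I \<union> U) (b' - c)
      \<le> ennreal (exp (- c / B) ^ card U) * slice_vol a J (I \<union> U) b'" if "b' \<le> B" for b'
    by (rule insert.IH) (use insert.prems that in auto)
  have Jm': "\<And>i. i \<in> I \<union> U \<Longrightarrow> J i \<in> sets borel" using Jm by auto
  note meas = slice_vol_measurable[OF fin Jm', where a = a]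
  have [measurable]: "J e \<in> sets borel" using Jm by auto
  have "slice_vol a J (insert e I \<union> U) (b - c) =
     (\<integral>\<^sup>+y. indicator (J e) y * slice_vol a J (I \<union> U) (b - a e * y - c) \<partial>lborel)"
    unfolding un using fin e Jm by (subst slice_vol_insert) (auto simp: algebra_simps)
  also have "\<dots> \<le> (\<integral>\<^sup>+y. ennreal (exp (- c / B) ^ card U) *
      (indicator (J e) y * slice_vol a J (I \<union> U) (b - a e * y)) \<partial>lborel)"
  proof (intro nn_integral_mono)
    fix y
    show "indicator (J e) y * slice_vol a J (I \<union> U) (b - a e * y - c)
      \<le> ennreal (exp (- c / B) ^ card U) * (indicator (J e) y * slice_vol a J (I \<union> U) (b - a e * y))"
    proof (cases "y \<in> J e")
      case True
      then have "0 \<le> y" using insert.prems(2)[of e] by auto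
      then have "b - a e * y \<le> B" using ae insert.prems by (smt (verit) mult_nonneg_nonneg)
      then show ?thesis using True IH by simp
    qed simp
  qed
  also have "\<dots> = ennreal (exp (- c / B) ^ card U) *
      (\<integral>\<^sup>+y. indicator (J e) y * slice_vol a J (I \<union> U) (b - a e * y) \<partial>lborel)"
    using meas by (intro nn_integral_cmult) auto
  also have "\<dots> = ennreal (exp (- c / B) ^ card U) * slice_vol a J (insert e I \<union> U) b"
    unfolding un using fin e Jm by (subst slice_vol_insert) auto
  finally show ?case .
qed

text \<open>Translating coordinate \<open>e\<close> by \<open>p\<close> preserves volume and charges
  \<open>a e * p\<close> to the budget. The resulting half-lines, open and closed, differ only in a
  null set.\<close>

lemma slice_vol_shift:
  assumes "finite I" "e \<in> I" "\<And>i. i \<in> I \<Longrightarrow> J i \<in> sets borel" 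
  shows "slice_vol a (J(e := {p<..})) I b = slice_vol a (J(e := {0..})) I (b - a e * p)"
proof -
  define I' where "I' = I - {e}"
  have I: "I = insert e I'" "e \<notin> I'" "finite I'" using assms by (auto simp: I'_def)
  have [simp]: "slice_vol a (J(e := K)) I' c = slice_vol a J I' c" for K c
    unfolding slice_vol_def using I(2) by (intro arg_cong2[where f = emeasure] Collect_cong refl conj_cong PiE_cong arg_cong2[where f = "(\<in>)"]) auto
  have Jm: "\<And>i. i \<in> I' \<Longrightarrow> J i \<in> sets borel" using assms I by auto
  note meas = slice_vol_measurable[OF I(3) Jm, where a = a]
  have "slice_vol a (J(e := {p<..})) I b =
     (\<integral>\<^sup>+y. indicator {p<..} y * slice_vol a J I' (b - a e * y) \<partial>lborel)"
    unfolding I(1) using I Jm by (subst slice_vol_insert) auto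
  also have "\<dots> = (\<integral>\<^sup>+y. indicator {p<..} (p + 1 * y) * slice_vol a J I' (b - a e * (p + 1 * y)) \<partial>lborel)"
    using meas by (subst nn_integral_real_affine[where c = 1 and t = p]) auto
  also have "\<dots> = (\<integral>\<^sup>+y. indicator {0..} y * slice_vol a J I' (b - a e * p - a e * y) \<partial>lborel)"
  proof (intro nn_integral_cong_AE)
    show "AE y in lborel. indicator {p<..} (p + 1 * y) * slice_vol a J I' (b - a e * (p + 1 * y)) =
       indicator {0..} y * slice_vol a J I' (b - a e * p - a e * y)"
      using AE_lborel_singleton[of 0]
      by eventually_elim (auto simp: indicator_def algebra_simps)
  qed
  also have "\<dots> = slice_vol a (J(e := {0..})) I (b - a e * p)"
    unfolding I(1) using I Jm by (subst slice_vol_insert) auto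
  finally show ?thesis .
qed

text \<open>Spending at most half of the budget on each new coordinate leaves a subregion of
  positive volume. With \<open>slice_vol_finite\<close> this makes the uniform distribution on the
  simplex a probability measure.\<close>

lemma slice_vol_pos:
  assumes "finite I" "\<And>i. i \<in> I \<Longrightarrow> 0 < a i" "0 < b"
  shows "0 < slice_vol a (\<lambda>_. {0..}) I b"
  using assms
proof (induction I arbitrary: b)
  case empty
  then show ?case by (simp add: slice_vol_empty)
next
  case (insert e I)
  have ae: "0 < a e" and IH: "0 < slice_vol a (\<lambda>_. {0..}) I (b / 2)"
    using insert by auto
  have "0 < slice_vol a (\<lambda>_. {0..}) I (b / 2) * ennreal (b / (2 * a e))"
    using IH ae insert.prems by (simp add: ennreal_zero_less_mult_iff)
  also have "\<dots> = (\<integral>\<^sup>+y. slice_vol a (\<lambda>_. {0..}) I (b / 2) * indicator {0..b / (2 * a e)} y \<partial>lborel)"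
    using less_imp_le[OF ae] insert.prems(2) by (subst nn_integral_cmult_indicator) auto
  also have "\<dots> \<le> (\<integral>\<^sup>+y. indicator {0..} y * slice_vol a (\<lambda>_. {0..}) I (b - a e * y) \<partial>lborel)"
  proof (intro nn_integral_mono)
    fix y
    show "slice_vol a (\<lambda>_. {0..}) I (b / 2) * indicator {0..b / (2 * a e)} y
       \<le> indicator {0..} y * slice_vol a (\<lambda>_. {0..}) I (b - a e * y)"
    proof (cases "y \<in> {0..b / (2 * a e)}")
      case True
      then have "b / 2 \<le> b - a e * y" using ae by (auto simp: field_simps)
      then have "slice_vol a (\<lambda>_. {0..}) I (b / 2) \<le> slice_vol a (\<lambda>_. {0..}) I (b - a e * y)"
        using insert by (intro slice_vol_mono) auto
      then show ?thesis using True by simp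
    qed simp
  qed
  also have "\<dots> = slice_vol a (\<lambda>_. {0..}) (insert e I) b"
    using insert by (subst slice_vol_insert) auto
  finally show ?case .
qed

section \<open>Volumes under a prescribed edge pattern\<close>

text \<open>\<open>Z\<close> is the set of exposed pairs and \<open>B\<close> the set of edges seen
  among them; an unexposed coordinate ranges over the whole half-line.\<close>

definition edge_pattern :: "real \<Rightarrow> 'i set \<Rightarrow> 'i set \<Rightarrow> 'i \<Rightarrow> real set" where
  "edge_pattern p Z B i = (if i \<in> Z then if i \<in> B then {0..p} else {p<..} else {0..})"

lemma edge_pattern_borel: "edge_pattern p Z B i \<in> sets borel"
  by (simp add: edge_pattern_def)

lemma edge_pattern_nonneg: "0 \<le> p \<Longrightarrow> edge_pattern p Z B i \<subseteq> {0..}"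
  by (auto simp: edge_pattern_def)

lemma slice_vol_cong:
  "(\<And>i. i \<in> I \<Longrightarrow> J i = J' i) \<Longrightarrow> slice_vol a J I b = slice_vol a J' I b"
  unfolding slice_vol_def by (metis PiE_cong)

text \<open>Turns the conditional probability that \<open>e\<close> is absent into a ratio of
  volumes of one and the same region at two budgets.\<close>

lemma slice_vol_absent:
  assumes "finite I" "e \<in> I" "e \<notin> Z"
  shows "slice_vol a (edge_pattern p (insert e Z) (B - {e})) I b =
     slice_vol a (edge_pattern p Z B) I (b - a e * p)"
proof -
  have "slice_vol a (edge_pattern p (insert e Z) (B - {e})) I b
      = slice_vol a ((edge_pattern p Z B)(e := {p<..})) I b"
    by (intro slice_vol_cong) (auto simp: edge_pattern_def)
  also have "\<dots> = slice_vol a ((edge_pattern p Z B)(e := {0..})) I (b - a e * p)"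
    using assms by (intro slice_vol_shift edge_pattern_borel)
  also have "\<dots> = slice_vol a (edge_pattern p Z B) I (b - a e * p)"
    using assms by (intro slice_vol_cong) (auto simp: edge_pattern_def)
  finally show ?thesis .
qed

text \<open>The unexposed coordinates \<open>I - Z\<close> act as the set \<open>U\<close> of
  \<open>slice_vol_diff_le\<close>, with the full budget as \<open>B\<close>.\<close>

lemma slice_vol_absent_le:
  fixes a :: "'i \<Rightarrow> real" and p b :: real
  assumes "finite I" "e \<in> I" "e \<notin> Z" "Z \<subseteq> I" "\<And>i. i \<in> I \<Longrightarrow> 0 < a i" "0 \<le> p" "0 < b"
  shows "slice_vol a (edge_pattern p (insert e Z) (B - {e})) I b
    \<le> ennreal (exp (- (a e * p) / b) ^ (card I - card Z)) * slice_vol a (edge_pattern p Z B) I b"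
proof -
  have "slice_vol a (edge_pattern p Z B) (Z \<union> (I - Z)) (b - a e * p)
    \<le> ennreal (exp (- (a e * p) / b) ^ card (I - Z)) * slice_vol a (edge_pattern p Z B) (Z \<union> (I - Z)) b"
    using assms(1-7) less_imp_le[OF assms(5), of e]
    by (intro slice_vol_diff_le edge_pattern_borel edge_pattern_nonneg)
      (auto simp: edge_pattern_def intro: finite_subset)
  moreover have "Z \<union> (I - Z) = I" using assms by auto
  moreover have "card (I - Z) = card I - card Z"
    using assms by (intro card_Diff_subset) (auto intro: finite_subset)
  ultimately show ?thesis using assms by (simp add: slice_vol_absent)
qed

text \<open>The region cut out by the pattern is star-shaped about the corner with coordinates \<open>p\<close> at the
  absent edges and \<open>0\<close> elsewhere; contracting towards it trades budget for volume.\<close>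

lemma slice_vol_absent_ge:
  fixes a :: "'i \<Rightarrow> real" and p b :: real
  assumes "finite I" "e \<in> I" "e \<notin> Z" "Z \<subseteq> I" "\<And>i. i \<in> I \<Longrightarrow> 0 < a i" "0 \<le> p"
    and b: "(\<Sum>i\<in>insert e Z. a i * p) < b"
  shows "ennreal (1 - card I * (a e * p) / (b - (\<Sum>i\<in>Z. a i * p))) * slice_vol a (edge_pattern p Z B) I b
    \<le> slice_vol a (edge_pattern p (insert e Z) (B - {e})) I b"
proof -
  define j where "j = (\<lambda>i. if i \<in> Z - B then p else 0)"
  define s where "s = (\<Sum>i\<in>I. a i * j i)"
  \<comment> \<open>The corner \<open>j\<close> costs \<open>s\<close>. This is the ratio for which
    contraction towards it lowers the budget from \<open>b\<close> to exactly
    \<open>b - a e * p\<close>.\<close>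
  define r where "r = 1 - a e * p / (b - s)"
  have fZ: "finite Z" using assms finite_subset by blast
  have "s = (\<Sum>i\<in>Z. a i * j i)"
    unfolding s_def using assms by (intro sum.mono_neutral_right) (auto simp: j_def)
  also have "\<dots> \<le> (\<Sum>i\<in>Z. a i * p)"
    using assms less_imp_le[OF assms(5)] by (intro sum_mono mult_left_mono) (auto simp: j_def)
  finally have s: "s \<le> (\<Sum>i\<in>Z. a i * p)" .
  have ep: "0 \<le> a e * p" using assms less_imp_le[OF assms(5)] by simp
  have bZ: "(\<Sum>i\<in>Z. a i * p) + a e * p < b" using b fZ assms by simp
  have bs: "a e * p < b - s" "0 < b - s" using bZ s ep by auto
  then have r: "0 < r" "r \<le> 1" using ep by (auto simp: r_def field_simps)
  have "ennreal (r ^ card I) * slice_vol a (edge_pattern p Z B) I (s + (b - s))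
     \<le> slice_vol a (edge_pattern p Z B) I (s + r * (b - s))"
    unfolding s_def
  proof (rule slice_vol_scale[OF assms(1) edge_pattern_borel r(1)])
    fix i y assume "y \<in> edge_pattern p Z B i"
    moreover have "y = y * (1 - r) + r * y" by (simp add: algebra_simps)
    moreover have "p < p + r * (y - p)" if "p < y" using that r by simp
    moreover have "0 \<le> r * y" "r * y \<le> y" if "0 \<le> y" using that r by (auto intro: mult_left_le_one_le)
    ultimately show "j i + r * (y - j i) \<in> edge_pattern p Z B i"
      by (auto simp: j_def edge_pattern_def)
  qed
  also have "s + r * (b - s) = b - a e * p" using bs by (simp add: r_def field_simps)
  finally have le: "ennreal (r ^ card I) * slice_vol a (edge_pattern p Z B) I b
      \<le> slice_vol a (edge_pattern p (insert e Z) (B - {e})) I b"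
    using assms by (simp add: slice_vol_absent)
  \<comment> \<open>Bernoulli's inequality makes the bound linear. Replacing \<open>s\<close> by the
    cost of having all of \<open>Z\<close> absent removes the dependence on
    \<open>B\<close>.\<close>
  have "1 - card I * (a e * p) / (b - (\<Sum>i\<in>Z. a i * p)) \<le> 1 + card I * (r - 1)"
  proof -
    have "a e * p / (b - s) \<le> a e * p / (b - (\<Sum>i\<in>Z. a i * p))"
      using ep s bZ by (intro divide_left_mono) auto
    then have "card I * (a e * p / (b - s)) \<le> card I * (a e * p / (b - (\<Sum>i\<in>Z. a i * p)))"
      by (intro mult_left_mono) auto
    then show ?thesis by (simp add: r_def)
  qed
  also have "\<dots> \<le> (1 + (r - 1)) ^ card I"
    using r by (intro Bernoulli_inequality) auto
  finally have "ennreal (1 - card I * (a e * p) / (b - (\<Sum>i\<in>Z. a i * p))) \<le> ennreal (r ^ card I)"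
    by (simp add: ennreal_leI)
  then show ?thesis using le by (meson mult_right_mono order_trans zero_le)
qed

section \<open>Graph masses and cylinders\<close>

lemma finite_pairs [simp]: "finite (pairs n)"
  by (rule finite_subset[of _ "Pow {1..n}"]) (auto simp: pairs_def)

lemma card_pairs: "card (pairs n) = n choose 2"
  unfolding pairs_def by (subst n_subsets) auto

text \<open>The mass function of the random graph. The exploration arguments see the simplex only
  through it, as a weight on the finite set of graphs.\<close>

definition graph_prob :: "nat \<Rightarrow> (nat set \<Rightarrow> real) \<Rightarrow> real \<Rightarrow> nat set set \<Rightarrow> real" where
  "graph_prob n \<alpha> p F =
     measure (unif_simplex n \<alpha>) {X \<in> space (unif_simplex n \<alpha>). threshold_graph n p X = F}"

lemma threshold_graph_subset: "threshold_graph n p X \<subseteq> pairs n"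
  by (auto simp: threshold_graph_def)

text \<open>The graphs compatible with having exposed \<open>Z\<close> and seen exactly the edges
  \<open>B\<close>. Conditional probabilities are ratios of sums over cylinders; all bounds are
  stated multiplied out, so cylinders of mass 0 need no separate treatment.\<close>

definition cyl :: "nat \<Rightarrow> nat set set \<Rightarrow> nat set set \<Rightarrow> nat set set set" where
  "cyl n Z B = {F \<in> Pow (pairs n). F \<inter> Z = B}"

lemma finite_cyl [simp]: "finite (cyl n Z B)"
  by (simp add: cyl_def)

lemma cyl_absent:
  assumes "B \<subseteq> Z" "e \<notin> Z"
  shows "{F \<in> cyl n Z B. e \<notin> F} = cyl n (insert e Z) B"
  using assms by (auto simp: cyl_def)

lemma sum_cyl_split:
  fixes f :: "nat set set \<Rightarrow> real"
  shows "sum f (cyl n Z B) = (\<Sum>F | F \<in> cyl n Z B \<and> e \<in> F. f F) + (\<Sum>F | F \<in> cyl n Z B \<and> e \<notin> F. f F)"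
proof -
  have "cyl n Z B = {F. F \<in> cyl n Z B \<and> e \<in> F} \<union> {F. F \<in> cyl n Z B \<and> e \<notin> F}" by auto
  then show ?thesis by (subst (1) \<open>cyl n Z B = _\<close>) (intro sum.union_disjoint, auto)
qed

section \<open>Random graphs from the simplex\<close>

locale simplex_graph =
  fixes n :: nat and \<alpha> :: "nat set \<Rightarrow> real" and p :: real
  assumes n2: "2 \<le> n" and pos: "\<And>e. e \<in> pairs n \<Longrightarrow> 0 < \<alpha> e"
begin

abbreviation "base \<equiv> Pi\<^sub>M (pairs n) (\<lambda>_. lborel :: real measure)"
abbreviation "\<mu> \<equiv> unif_simplex n \<alpha>"
abbreviation "N \<equiv> real (n choose 2)"
abbreviation "m \<equiv> graph_prob n \<alpha> p"

lemma N_pos: "0 < N"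
  using n2 by (simp add: zero_less_binomial_iff)

lemma simplex_sets: "weighted_simplex n \<alpha> \<in> sets base"
  unfolding weighted_simplex_def by (intro slice_sets) auto

lemma simplex_vol:
  "emeasure base (weighted_simplex n \<alpha>) \<noteq> 0" "emeasure base (weighted_simplex n \<alpha>) \<noteq> \<infinity>"
proof -
  have "emeasure base (weighted_simplex n \<alpha>) = slice_vol \<alpha> (\<lambda>_. {0..}) (pairs n) N"
    by (simp add: weighted_simplex_def slice_vol_def)
  then show "emeasure base (weighted_simplex n \<alpha>) \<noteq> 0" "emeasure base (weighted_simplex n \<alpha>) \<noteq> \<infinity>"
    using slice_vol_pos[of "pairs n" \<alpha> N] slice_vol_finite[of "pairs n" "\<lambda>_. {0..}" \<alpha> N] pos N_pos
    by auto
qed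

sublocale prob_space \<mu>
  unfolding unif_simplex_def using simplex_vol by (intro prob_space_uniform_measure)

lemma space_\<mu>: "space \<mu> = space base" and sets_\<mu>: "sets \<mu> = sets base"
  by (simp_all add: unif_simplex_def)

lemma edge_event: "e \<in> pairs n \<Longrightarrow> {X \<in> space \<mu>. e \<in> threshold_graph n p X} \<in> sets \<mu>"
proof -
  assume e: "e \<in> pairs n"
  then have [measurable]: "(\<lambda>X. X e) \<in> borel_measurable base"
    using measurable_component_singleton[of e "pairs n" "\<lambda>_. lborel :: real measure"] by simp
  have "{X \<in> space base. X e \<le> p} \<in> sets base" by measurable
  with e show ?thesis by (simp add: space_\<mu> sets_\<mu> threshold_graph_def)
qed

lemma graph_event: "{X \<in> space \<mu>. threshold_graph n p X = F} \<in> sets \<mu>"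
proof (cases "F \<subseteq> pairs n")
  case True
  have *: "{X \<in> space \<mu>. threshold_graph n p X = F} =
     {X \<in> space \<mu>. \<forall>e\<in>pairs n. e \<in> threshold_graph n p X \<longleftrightarrow> e \<in> F}"
    using True threshold_graph_subset by fast
  have "{X \<in> space \<mu>. e \<in> threshold_graph n p X \<longleftrightarrow> e \<in> F} \<in> sets \<mu>" if "e \<in> pairs n" for e
  proof (cases "e \<in> F")
    case False
    then have "{X \<in> space \<mu>. e \<in> threshold_graph n p X \<longleftrightarrow> e \<in> F} =
       space \<mu> - {X \<in> space \<mu>. e \<in> threshold_graph n p X}" by auto
    then show ?thesis using edge_event[OF that] by auto
  qed (simp add: edge_event[OF that])
  then show ?thesis
    unfolding * by (intro sets.sets_Collect_finite_All) auto
next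
  case False
  then have "{X \<in> space \<mu>. threshold_graph n p X = F} = {}"
    using threshold_graph_subset by auto
  then show ?thesis by (simp only: sets.empty_sets)
qed

lemma prob_graph:
  "\<P>(X in \<mu>. \<Phi> (threshold_graph n p X)) = (\<Sum>F | F \<in> Pow (pairs n) \<and> \<Phi> F. m F)"
proof -
  have "{X \<in> space \<mu>. \<Phi> (threshold_graph n p X)} =
    (\<Union>F\<in>{F. F \<in> Pow (pairs n) \<and> \<Phi> F}. {X \<in> space \<mu>. threshold_graph n p X = F})"
    using threshold_graph_subset by auto
  then show ?thesis
    unfolding graph_prob_def using graph_event
    by (simp only:) (intro finite_measure_finite_Union, auto simp: disjoint_family_on_def)
qed

lemma graph_event': "{X \<in> space \<mu>. \<Phi> (threshold_graph n p X)} \<in> sets \<mu>"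
proof -
  have "{X \<in> space \<mu>. \<Phi> (threshold_graph n p X)} =
    (\<Union>F\<in>{F. F \<in> Pow (pairs n) \<and> \<Phi> F}. {X \<in> space \<mu>. threshold_graph n p X = F})"
    using threshold_graph_subset by auto
  then show ?thesis using graph_event by (simp only:) (intro sets.finite_UN, auto)
qed

lemma sum_graph_prob: "sum m (Pow (pairs n)) = 1"
  using prob_graph[of "\<lambda>_. True"] prob_space by (simp add: Pow_def)

lemma graph_prob_nonneg: "0 \<le> m F"
  by (simp add: graph_prob_def)

text \<open>The bridge from graphs to geometry: an exposure fixes on which side of \<open>p\<close>
  each exposed coordinate lies, and the uniform measure turns the resulting region into a ratio of
  volumes. The condition \<open>0 \<le> p\<close> keeps the pattern inside the orthant.\<close>

lemma sum_cyl:
  assumes "0 \<le> p" "B \<subseteq> Z" "Z \<subseteq> pairs n"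
  shows "ennreal (sum m (cyl n Z B)) =
    slice_vol \<alpha> (edge_pattern p Z B) (pairs n) N / emeasure base (weighted_simplex n \<alpha>)"
proof -
  let ?A = "{X \<in> space \<mu>. threshold_graph n p X \<inter> Z = B}"
  have "sum m (cyl n Z B) = prob ?A"
    using prob_graph[of "\<lambda>F. F \<inter> Z = B"] by (simp add: cyl_def)
  then have "ennreal (sum m (cyl n Z B)) = emeasure \<mu> ?A" by (simp add: emeasure_eq_measure)
  also have "\<dots> = emeasure base (weighted_simplex n \<alpha> \<inter> ?A) / emeasure base (weighted_simplex n \<alpha>)"
    unfolding unif_simplex_def
    by (rule emeasure_uniform_measure[OF simplex_sets])
      (use graph_event'[of "\<lambda>F. F \<inter> Z = B"] in \<open>simp add: sets_\<mu> space_\<mu>\<close>)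
  also have "weighted_simplex n \<alpha> \<inter> ?A =
     {x \<in> Pi\<^sub>E (pairs n) (edge_pattern p Z B). (\<Sum>i\<in>pairs n. \<alpha> i * x i) \<le> N}"
  proof (intro set_eqI iffI)
    fix X assume X: "X \<in> weighted_simplex n \<alpha> \<inter> ?A"
    then have "X e \<in> edge_pattern p Z B e" if "e \<in> pairs n" for e
      using that by (fastforce simp: weighted_simplex_def threshold_graph_def edge_pattern_def PiE_def Pi_def)
    with X show "X \<in> {x \<in> Pi\<^sub>E (pairs n) (edge_pattern p Z B). (\<Sum>i\<in>pairs n. \<alpha> i * x i) \<le> N}"
      by (auto simp: weighted_simplex_def PiE_def Pi_def)
  next
    fix X assume X: "X \<in> {x \<in> Pi\<^sub>E (pairs n) (edge_pattern p Z B). (\<Sum>i\<in>pairs n. \<alpha> i * x i) \<le> N}"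
    then have P: "X e \<in> edge_pattern p Z B e" if "e \<in> pairs n" for e
      using that by (auto simp: PiE_def Pi_def)
    then have "0 \<le> X e" if "e \<in> pairs n" for e
      using that edge_pattern_nonneg[OF assms(1)] by (metis atLeast_iff subsetD)
    moreover have "threshold_graph n p X \<inter> Z = B"
    proof (intro set_eqI iffI)
      fix e assume "e \<in> threshold_graph n p X \<inter> Z"
      then show "e \<in> B" using P[of e] by (auto simp: threshold_graph_def edge_pattern_def split: if_splits)
    next
      fix e assume "e \<in> B"
      then show "e \<in> threshold_graph n p X \<inter> Z"
        using P[of e] assms by (auto simp: threshold_graph_def edge_pattern_def subset_iff)
    qed
    ultimately show "X \<in> weighted_simplex n \<alpha> \<inter> ?A"
      using X by (auto simp: weighted_simplex_def space_\<mu> space_PiM PiE_def Pi_def)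
  qed
  finally show ?thesis by (simp add: slice_vol_def)
qed

lemma sum_absent_le:
  assumes "0 \<le> p" "Z \<subseteq> pairs n" "e \<in> pairs n - Z"
  shows "(\<Sum>F | F \<in> cyl n Z B \<and> e \<notin> F. m F)
     \<le> exp (- (\<alpha> e * p) / N) ^ ((n choose 2) - card Z) * sum m (cyl n Z B)"
proof (cases "B \<subseteq> Z")
  case True
  let ?V = "emeasure base (weighted_simplex n \<alpha>)"
  have B: "B - {e} = B" using True assms by auto
  have "ennreal (\<Sum>F | F \<in> cyl n Z B \<and> e \<notin> F. m F) =
     slice_vol \<alpha> (edge_pattern p (insert e Z) (B - {e})) (pairs n) N / ?V"
    unfolding B using assms True sum_cyl[of B "insert e Z"] by (subst cyl_absent) auto
  also have "\<dots> \<le> (ennreal (exp (- (\<alpha> e * p) / N) ^ ((n choose 2) - card Z)) *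
      slice_vol \<alpha> (edge_pattern p Z B) (pairs n) N) / ?V"
    using slice_vol_absent_le[of "pairs n" e Z \<alpha> p N B] assms pos N_pos
    by (intro divide_right_mono_ennreal) (auto simp: card_pairs)
  also have "\<dots> = ennreal (exp (- (\<alpha> e * p) / N) ^ ((n choose 2) - card Z)) * ennreal (sum m (cyl n Z B))"
    using assms True by (simp add: sum_cyl ennreal_times_divide)
  also have "\<dots> = ennreal (exp (- (\<alpha> e * p) / N) ^ ((n choose 2) - card Z) * sum m (cyl n Z B))"
    by (simp add: ennreal_mult graph_prob_nonneg sum_nonneg)
  finally show ?thesis
    by (subst (asm) ennreal_le_iff) (auto intro!: mult_nonneg_nonneg sum_nonneg graph_prob_nonneg)
next
  case False
  then have "cyl n Z B = {}" by (auto simp: cyl_def)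
  then show ?thesis by simp
qed

text \<open>\<open>slice_vol_absent_ge\<close> bounds the mass where \<open>e\<close> is absent from
  below by the fraction \<open>1 - q\<close>; the claim is the complement.\<close>

lemma sum_present_le:
  assumes "Z \<subseteq> pairs n" "e \<in> pairs n - Z" "(\<Sum>i\<in>insert e Z. \<alpha> i * p) < N"
    and q: "N * (\<alpha> e * p) / (N - (\<Sum>i\<in>Z. \<alpha> i * p)) \<le> q" "0 \<le> q" "q \<le> 1"
  shows "(\<Sum>F | F \<in> cyl n Z B \<and> e \<in> F. m F) \<le> q * sum m (cyl n Z B)"
proof (cases "0 \<le> p")
  case p: True
  show ?thesis
  proof (cases "B \<subseteq> Z")
    case True
    let ?V = "emeasure base (weighted_simplex n \<alpha>)"
    have B: "B - {e} = B" using True assms by auto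
    have "ennreal ((1 - q) * sum m (cyl n Z B)) =
       ennreal (1 - q) * slice_vol \<alpha> (edge_pattern p Z B) (pairs n) N / ?V"
      using q assms True p
      by (simp add: ennreal_mult graph_prob_nonneg sum_nonneg sum_cyl ennreal_times_divide)
    also have "\<dots> \<le> slice_vol \<alpha> (edge_pattern p (insert e Z) (B - {e})) (pairs n) N / ?V"
    proof (intro divide_right_mono_ennreal)
      have "ennreal (1 - q) \<le> ennreal (1 - real (card (pairs n)) * (\<alpha> e * p) / (N - (\<Sum>i\<in>Z. \<alpha> i * p)))"
        using q by (intro ennreal_leI) (simp add: card_pairs)
      then have "ennreal (1 - q) * slice_vol \<alpha> (edge_pattern p Z B) (pairs n) N
         \<le> ennreal (1 - real (card (pairs n)) * (\<alpha> e * p) / (N - (\<Sum>i\<in>Z. \<alpha> i * p))) *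
            slice_vol \<alpha> (edge_pattern p Z B) (pairs n) N"
        by (rule mult_right_mono) simp
      also have "\<dots> \<le> slice_vol \<alpha> (edge_pattern p (insert e Z) (B - {e})) (pairs n) N"
        using assms pos p by (intro slice_vol_absent_ge) auto
      finally show "ennreal (1 - q) * slice_vol \<alpha> (edge_pattern p Z B) (pairs n) N
         \<le> slice_vol \<alpha> (edge_pattern p (insert e Z) (B - {e})) (pairs n) N" .
    qed
    also have "\<dots> = ennreal (\<Sum>F | F \<in> cyl n Z B \<and> e \<notin> F. m F)"
      unfolding B using assms True p sum_cyl[of B "insert e Z"]
      by (subst cyl_absent) (auto simp: subset_insertI2)
    finally have "(1 - q) * sum m (cyl n Z B) \<le> (\<Sum>F | F \<in> cyl n Z B \<and> e \<notin> F. m F)"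
      by (subst (asm) ennreal_le_iff) (auto intro!: sum_nonneg graph_prob_nonneg)
    moreover have "sum m (cyl n Z B) =
       (\<Sum>F | F \<in> cyl n Z B \<and> e \<in> F. m F) + (\<Sum>F | F \<in> cyl n Z B \<and> e \<notin> F. m F)"
      by (rule sum_cyl_split)
    ultimately show ?thesis by (simp add: algebra_simps)
  next
    case False
    then have "cyl n Z B = {}" by (auto simp: cyl_def)
    then show ?thesis by simp
  qed
next
  \<comment> \<open>For negative \<open>p\<close> no coordinate of a simplex point can lie below the
    threshold, so graphs containing \<open>e\<close> have mass 0. The case arises since the
    subcritical regime bounds \<open>p\<close> only from above.\<close>
  case False
  let ?A = "{X \<in> space \<mu>. e \<in> threshold_graph n p X}"
  have "m F = 0" if "e \<in> F" for F
  proof -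
    have "emeasure \<mu> ?A = emeasure base (weighted_simplex n \<alpha> \<inter> ?A) / emeasure base (weighted_simplex n \<alpha>)"
      unfolding unif_simplex_def
      by (rule emeasure_uniform_measure[OF simplex_sets])
        (use graph_event'[of "\<lambda>F. e \<in> F"] in \<open>simp add: sets_\<mu> space_\<mu>\<close>)
    also have "weighted_simplex n \<alpha> \<inter> ?A = {}"
      using False by (fastforce simp: weighted_simplex_def threshold_graph_def PiE_def Pi_def)
    finally have "prob ?A = 0" by (simp add: measure_def)
    moreover have "m F \<le> prob ?A"
      unfolding graph_prob_def using that graph_event'[of "\<lambda>F. e \<in> F"] by (intro finite_measure_mono) auto
    ultimately show ?thesis using graph_prob_nonneg[of F] by simp
  qed
  then show ?thesis using q by (simp add: sum_nonneg graph_prob_nonneg)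
qed

end

section \<open>Exploration\<close>

type_synonym state = "nat set \<times> nat set"

text \<open>A state is a pair of the explored and the active vertices. When no vertex is active, the exploration
  restarts at an unexplored vertex; \<open>Min\<close> is a junk value only once all vertices are explored. An exploration
  may start with explored vertices, which it then avoids.\<close>

definition next_vertex :: "nat \<Rightarrow> state \<Rightarrow> nat" where
  "next_vertex n s = (if snd s \<noteq> {} then Min (snd s) else Min ({1..n} - fst s))"

text \<open>The next vertex is removed explicitly because after a restart it comes from outside
  \<open>snd s\<close>.\<close>

definition fresh :: "nat \<Rightarrow> state \<Rightarrow> nat set" where
  "fresh n s = {1..n} - fst s - snd s - {next_vertex n s}"

definition discovered :: "nat \<Rightarrow> nat set set \<Rightarrow> state \<Rightarrow> nat set" where
  "discovered n F s = {x \<in> fresh n s. {next_vertex n s, x} \<in> F}"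

definition step :: "nat \<Rightarrow> nat set set \<Rightarrow> state \<Rightarrow> state" where
  "step n F s = (insert (next_vertex n s) (fst s),
     snd s - {next_vertex n s} \<union> discovered n F s)"

definition explore :: "nat \<Rightarrow> nat set set \<Rightarrow> nat \<Rightarrow> state \<Rightarrow> state" where
  "explore n F t = step n F ^^ t"

definition found :: "nat \<Rightarrow> nat set set \<Rightarrow> nat \<Rightarrow> state \<Rightarrow> nat" where
  "found n F t s = (\<Sum>j<t. card (discovered n F (explore n F j s)))"

text \<open>Each fresh vertex costs one tested pair, so this counts the trials of which
  \<open>found\<close> counts the successes.\<close>

definition queries :: "nat \<Rightarrow> nat set set \<Rightarrow> nat \<Rightarrow> state \<Rightarrow> nat" where
  "queries n F t s = (\<Sum>j<t. card (fresh n (explore n F j s)))"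

definition valid :: "nat \<Rightarrow> state \<Rightarrow> bool" where
  "valid n s \<longleftrightarrow> fst s \<subseteq> {1..n} \<and> snd s \<subseteq> {1..n} \<and> fst s \<inter> snd s = {}"

text \<open>A superset of the pairs tested while exploring \<open>D\<close>. Conditioning on all of
  it makes the exposed set depend on the explored vertices alone.\<close>

definition touching :: "nat \<Rightarrow> nat set \<Rightarrow> nat set set" where
  "touching n D = {e \<in> pairs n. e \<inter> D \<noteq> {}}"

lemma explore_0 [simp]: "explore n F 0 s = s"
  by (simp add: explore_def)

lemma explore_Suc: "explore n F (Suc t) s = step n F (explore n F t s)"
  by (simp add: explore_def)

lemma explore_Suc': "explore n F (Suc t) s = explore n F t (step n F s)"
  by (simp add: explore_def funpow_Suc_right del: funpow.simps)

lemma found_0 [simp]: "found n F 0 s = 0" and queries_0 [simp]: "queries n F 0 s = 0"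
  by (simp_all add: found_def queries_def)

lemma found_Suc: "found n F (Suc t) s = found n F t s + card (discovered n F (explore n F t s))"
  by (simp add: found_def)

lemma found_Suc': "found n F (Suc t) s = card (discovered n F s) + found n F t (step n F s)"
  unfolding found_def by (subst sum.lessThan_Suc_shift) (simp add: explore_Suc')

lemma queries_Suc': "queries n F (Suc t) s = card (fresh n s) + queries n F t (step n F s)"
  unfolding queries_def by (subst sum.lessThan_Suc_shift) (simp add: explore_Suc')

lemma valid_finite: "valid n s \<Longrightarrow> finite (fst s) \<and> finite (snd s)"
  by (auto simp: valid_def intro: finite_subset)

lemma next_vertex_in:
  assumes "valid n s" "card (fst s) < n"
  shows "next_vertex n s \<in> {1..n}" "next_vertex n s \<notin> fst s"
    "snd s \<noteq> {} \<Longrightarrow> next_vertex n s \<in> snd s"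
proof -
  have "{1..n} - fst s \<noteq> {}"
  proof
    assume "{1..n} - fst s = {}"
    then have "card {1..n} \<le> card (fst s)"
      using valid_finite[OF assms(1)] by (intro card_mono) auto
    then show False using assms by simp
  qed
  then have 1: "Min ({1..n} - fst s) \<in> {1..n} - fst s" by (intro Min_in) auto
  have 2: "Min (snd s) \<in> snd s" "Min (snd s) \<in> {1..n}" "Min (snd s) \<notin> fst s" if "snd s \<noteq> {}"
  proof -
    show "Min (snd s) \<in> snd s" using that valid_finite[OF assms(1)] by (intro Min_in) auto
    then show "Min (snd s) \<in> {1..n}" "Min (snd s) \<notin> fst s" using assms(1) by (auto simp: valid_def)
  qed
  show "next_vertex n s \<in> {1..n}" "next_vertex n s \<notin> fst s"
    "snd s \<noteq> {} \<Longrightarrow> next_vertex n s \<in> snd s"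
    using 1 2 by (auto simp: next_vertex_def)
qed

lemma finite_fresh [simp]: "finite (fresh n s)" and finite_discovered [simp]: "finite (discovered n F s)"
  by (auto simp: fresh_def discovered_def)

lemma valid_step:
  assumes "valid n s" "card (fst s) < n"
  shows "valid n (step n F s)" "card (fst (step n F s)) = Suc (card (fst s))"
  using next_vertex_in[OF assms] assms(1) valid_finite[OF assms(1)]
  by (auto simp: step_def valid_def discovered_def fresh_def)

lemma valid_explore:
  assumes "valid n s" "card (fst s) + t \<le> n"
  shows "valid n (explore n F t s)" "card (fst (explore n F t s)) = card (fst s) + t"
proof -
  have "valid n (explore n F t s) \<and> card (fst (explore n F t s)) = card (fst s) + t"
    using assms by (induction t) (auto simp: explore_Suc valid_step)
  then show "valid n (explore n F t s)" "card (fst (explore n F t s)) = card (fst s) + t" by auto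
qed

lemma explore_mono: "t \<le> t' \<Longrightarrow> fst (explore n F t s) \<subseteq> fst (explore n F t' s)"
  by (rule lift_Suc_mono_le[of "\<lambda>t. fst (explore n F t s)"]) (auto simp: explore_Suc step_def)

lemma explore_seen_mono:
  "t \<le> t' \<Longrightarrow> fst (explore n F t s) \<union> snd (explore n F t s) \<subseteq> fst (explore n F t' s) \<union> snd (explore n F t' s)"
  by (rule lift_Suc_mono_le[of "\<lambda>t. fst (explore n F t s) \<union> snd (explore n F t s)"])
    (auto simp: explore_Suc step_def)

text \<open>A step adds all discovered vertices to the active ones and removes at most one. A
  restart removes none, whence an inequality.\<close>

lemma found_le_active:
  assumes "valid n s" "card (fst s) + t \<le> n"
  shows "found n F t s \<le> card (snd (explore n F t s)) + t"
  using assms(2)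
proof (induction t)
  case (Suc t)
  let ?s = "explore n F t s"
  have v: "valid n ?s" using Suc assms by (intro valid_explore) auto
  have fin: "finite (snd ?s)" using valid_finite[OF v] by simp
  have "card (snd (explore n F (Suc t) s)) = card (snd ?s - {next_vertex n ?s}) + card (discovered n F ?s)"
    unfolding explore_Suc using fin
    by (simp add: step_def) (intro card_Un_disjoint, auto simp: discovered_def fresh_def)
  moreover have "card (snd ?s) \<le> Suc (card (snd ?s - {next_vertex n ?s}))"
    by (metis card_Diff1_le card_Suc_Diff1 fin Diff_insert_absorb insert_absorb le_SucI le_refl Diff_empty Diff_insert0)
  ultimately show ?case using Suc by (simp add: found_Suc)
qed simp

text \<open>Seen vertices stay seen, so whatever is unseen at time \<open>t\<close> was fresh at
  every earlier step.\<close>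

lemma queries_ge:
  assumes "valid n s" "card (fst s) + t \<le> n"
  shows "t * (n - (card (fst s) + t + card (snd (explore n F t s)))) \<le> queries n F t s"
proof -
  let ?e = "\<lambda>j. explore n F j s"
  have vt: "valid n (?e t)" "card (fst (?e t)) = card (fst s) + t"
    using valid_explore[OF assms] by auto
  have "n - (card (fst s) + t + card (snd (?e t))) \<le> card (fresh n (?e j))" if "j < t" for j
  proof -
    have v: "valid n (?e j)" "card (fst (?e j)) < n"
      using valid_explore[OF assms(1), of j] that assms by auto
    have "{1..n} - (fst (?e t) \<union> snd (?e t)) \<subseteq> fresh n (?e j)"
      using explore_seen_mono[of "j" t n F s] explore_mono[of "Suc j" t n F s] that
      by (auto simp: fresh_def explore_Suc step_def)
    then have "card ({1..n} - (fst (?e t) \<union> snd (?e t))) \<le> card (fresh n (?e j))"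
      by (intro card_mono) auto
    moreover have "card ({1..n} - (fst (?e t) \<union> snd (?e t))) = n - card (fst (?e t) \<union> snd (?e t))"
      using vt valid_finite[OF vt(1)] by (subst card_Diff_subset) (auto simp: valid_def)
    moreover have "card (fst (?e t) \<union> snd (?e t)) \<le> card (fst s) + t + card (snd (?e t))"
      using card_Un_le[of "fst (?e t)" "snd (?e t)"] vt(2) by simp
    ultimately show ?thesis by linarith
  qed
  then have "(\<Sum>j<t. n - (card (fst s) + t + card (snd (?e t)))) \<le> queries n F t s"
    unfolding queries_def by (intro sum_mono) auto
  then show ?thesis by simp
qed

lemma queries_le: "queries n F t s \<le> t * n"
proof -
  have "card (fresh n s') \<le> card {1..n}" for s'
    by (intro card_mono) (auto simp: fresh_def)
  then have "queries n F t s \<le> (\<Sum>j<t. n)" unfolding queries_def by (intro sum_mono) simp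
  then show ?thesis by simp
qed

lemma touching_subset: "touching n D \<subseteq> pairs n"
  by (auto simp: touching_def)

lemma card_touching:
  assumes "D \<subseteq> {1..n}"
  shows "card (touching n D) \<le> card D * n"
proof -
  have "touching n D \<subseteq> (\<lambda>(u, x). {u, x}) ` (D \<times> {1..n})"
  proof
    fix e assume e: "e \<in> touching n D"
    then obtain u where u: "u \<in> e" "u \<in> D" "e \<in> pairs n" by (auto simp: touching_def)
    then obtain x where "e = {u, x}" by (auto simp: pairs_def card_2_iff)
    then show "e \<in> (\<lambda>(u, x). {u, x}) ` (D \<times> {1..n})"
      using u by (auto simp: pairs_def intro!: image_eqI[of _ _ "(u, x)"])
  qed
  moreover have "finite D" using assms finite_subset by blast
  ultimately have "card (touching n D) \<le> card ((\<lambda>(u, x). {u, x}) ` (D \<times> {1..n}))"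
    by (intro card_mono) auto
  also have "\<dots> \<le> card (D \<times> {1..n})"
    using finite_subset[OF assms] by (intro card_image_le) auto
  finally show ?thesis by (simp add: card_cartesian_product)
qed

section \<open>Exponential moments along the exploration\<close>

text \<open>Given the status of fewer than \<open>K\<close> pairs, the conditional expectation of \<open>w\<close> raised to the
  indicator of any other pair is at most \<open>r\<close>. Taking \<open>w < 1\<close> encodes a lower bound on the
  conditional edge probability, \<open>w > 1\<close> an upper bound.\<close>

definition tilted :: "nat \<Rightarrow> (nat set set \<Rightarrow> real) \<Rightarrow> nat \<Rightarrow> real \<Rightarrow> real \<Rightarrow> bool" where
  "tilted n m K w r \<longleftrightarrow> (\<forall>Z B e. Z \<subseteq> pairs n \<longrightarrow> card Z < K \<longrightarrow> e \<in> pairs n - Z \<longrightarrow>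
     w * (\<Sum>F | F \<in> cyl n Z B \<and> e \<in> F. m F) + (\<Sum>F | F \<in> cyl n Z B \<and> e \<notin> F. m F) \<le> r * sum m (cyl n Z B))"

text \<open>With this trivial weight, \<open>explore_bound\<close> reduces to a plain strong Markov
  property.\<close>

lemma tilted_1: "tilted n m K 1 1"
  unfolding tilted_def by (auto simp: sum_cyl_split[symmetric])

lemma cyl_present:
  assumes "B \<subseteq> Z" "e \<notin> Z"
  shows "{F \<in> cyl n Z B. e \<in> F} = cyl n (insert e Z) (insert e B)"
  using assms by (auto simp: cyl_def)

lemma cyl_empty: "\<not> B \<subseteq> Z \<Longrightarrow> cyl n Z B = {}"
  by (auto simp: cyl_def)

text \<open>The pairs of \<open>J\<close> are exposed one after the other, each contributing a
  factor \<open>r\<close>. The bound on \<open>card Z + card J\<close> keeps every stage within the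
  range of \<open>tilted\<close>.\<close>

lemma tilted_multi:
  assumes "tilted n m K w r" "0 \<le> w" "0 \<le> r" "finite J"
    and "Z \<subseteq> pairs n" "J \<subseteq> pairs n" "Z \<inter> J = {}" "card Z + card J \<le> K"
  shows "(\<Sum>F\<in>cyl n Z B. m F * w ^ card (F \<inter> J)) \<le> r ^ card J * sum m (cyl n Z B)"
  using assms(4-)
proof (induction J arbitrary: Z B)
  case (insert e J)
  show ?case
  proof (cases "B \<subseteq> Z")
    case True
    have e: "e \<notin> Z" "e \<in> pairs n" using insert by auto
    have fZ: "finite Z" using insert by (meson finite_pairs finite_subset)
    have fF: "finite (F \<inter> J)" for F using insert by auto
    let ?P = "cyl n (insert e Z) (insert e B)" and ?A = "cyl n (insert e Z) B"
    have "(\<Sum>F\<in>cyl n Z B. m F * w ^ card (F \<inter> insert e J)) =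
      (\<Sum>F\<in>?P. m F * w ^ card (F \<inter> insert e J)) + (\<Sum>F\<in>?A. m F * w ^ card (F \<inter> insert e J))"
      by (subst sum_cyl_split[of _ n Z B e]) (simp only: cyl_present[OF True e(1)] cyl_absent[OF True e(1)])
    also have "(\<Sum>F\<in>?P. m F * w ^ card (F \<inter> insert e J)) = w * (\<Sum>F\<in>?P. m F * w ^ card (F \<inter> J))"
    proof (subst sum_distrib_left, intro sum.cong refl)
      fix F assume "F \<in> ?P"
      then have "F \<inter> insert e J = insert e (F \<inter> J)" by (auto simp: cyl_def)
      then show "m F * w ^ card (F \<inter> insert e J) = w * (m F * w ^ card (F \<inter> J))"
        using insert.hyps fF by simp
    qed
    also have "(\<Sum>F\<in>?A. m F * w ^ card (F \<inter> insert e J)) = (\<Sum>F\<in>?A. m F * w ^ card (F \<inter> J))"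
    proof (intro sum.cong refl)
      fix F assume "F \<in> ?A"
      then have "F \<inter> insert e J = F \<inter> J" using True e by (auto simp: cyl_def)
      then show "m F * w ^ card (F \<inter> insert e J) = m F * w ^ card (F \<inter> J)" by simp
    qed
    also have "w * (\<Sum>F\<in>?P. m F * w ^ card (F \<inter> J)) + (\<Sum>F\<in>?A. m F * w ^ card (F \<inter> J))
      \<le> w * (r ^ card J * sum m ?P) + r ^ card J * sum m ?A"
      using insert.prems insert.hyps e fZ assms(2)
      by (intro add_mono mult_left_mono insert.IH) auto
    also have "\<dots> = r ^ card J * (w * sum m ?P + sum m ?A)" by (simp add: algebra_simps)
    also have "\<dots> \<le> r ^ card J * (r * sum m (cyl n Z B))"
    proof (intro mult_left_mono)
      have "card Z < K" using insert.prems insert.hyps by simp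
      then show "w * sum m ?P + sum m ?A \<le> r * sum m (cyl n Z B)"
        using assms(1)[unfolded tilted_def, rule_format, of Z e B] insert.prems e
        by (simp add: cyl_present[OF True e(1)] cyl_absent[OF True e(1)])
    qed (use assms in auto)
    finally show ?thesis using insert.hyps by (simp add: mult_ac)
  next
    case False
    then show ?thesis by (simp add: cyl_empty)
  qed
qed simp

text \<open>Law of total probability: the cylinders over \<open>Z'\<close> that meet
  \<open>cyl n Z B\<close> partition it.\<close>

lemma sum_cyl_mono:
  fixes g h :: "nat set set \<Rightarrow> real"
  assumes "Z \<subseteq> Z'" "\<And>B'. sum g (cyl n Z' B') \<le> sum h (cyl n Z' B')"
  shows "sum g (cyl n Z B) \<le> sum h (cyl n Z B)"
proof -
  have *: "{F \<in> cyl n Z B. F \<inter> Z' = B'} = cyl n Z' B'" if "B' \<in> (\<lambda>F. F \<inter> Z') ` cyl n Z B" for B'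
    using that assms(1) by (auto simp: cyl_def)
  have "sum f (cyl n Z B) = (\<Sum>B'\<in>(\<lambda>F. F \<inter> Z') ` cyl n Z B. sum f (cyl n Z' B'))" for f :: "nat set set \<Rightarrow> real"
    by (subst sum.image_gen[OF finite_cyl, of _ _ _ _ "\<lambda>F. F \<inter> Z'"]) (intro sum.cong refl, simp add: *)
  then show ?thesis using assms(2) by (simp add: sum_mono)
qed

text \<open>The product \<open>w ^ found / r ^ queries\<close> is a supermartingale along the exploration. The factor \<open>\<phi>\<close>
  acts as a strong Markov property: it may depend on pairs that do not touch the explored vertices.\<close>

lemma explore_bound:
  assumes tilt: "tilted n m K w r" and w: "0 \<le> w" and r: "0 < r" and \<kappa>: "0 \<le> \<kappa>" and m: "\<And>F. 0 \<le> m F"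
  assumes "valid n s" "card (fst s) + t \<le> n" "(card (fst s) + t) * n \<le> K"
    and "\<And>s' B'. valid n s' \<Longrightarrow> card (fst s') = card (fst s) + t \<Longrightarrow>
        (\<Sum>F\<in>cyl n (touching n (fst s')) B'. m F * \<phi> s' F) \<le> \<kappa> * sum m (cyl n (touching n (fst s')) B')"
  shows "(\<Sum>F\<in>cyl n (touching n (fst s)) B.
      m F * (w ^ found n F t s * (1 / r) ^ queries n F t s * \<phi> (explore n F t s) F))
    \<le> \<kappa> * sum m (cyl n (touching n (fst s)) B)"
  using assms(6-)
proof (induction t arbitrary: s B)
  case 0
  then show ?case by simp
next
  case (Suc t)
  define u where "u = next_vertex n s"
  define Z where "Z = touching n (fst s)"
  define Z' where "Z' = touching n (insert u (fst s))"
  define J where "J = (\<lambda>x. {u, x}) ` fresh n s"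
  have lt: "card (fst s) < n" using Suc.prems by simp
  note u = next_vertex_in[OF Suc.prems(1) lt, folded u_def]
  have inj: "inj_on (\<lambda>x. {u, x}) (fresh n s)" by (auto simp: inj_on_def doubleton_eq_iff)
  have cJ: "card J = card (fresh n s)" unfolding J_def using inj by (rule card_image)
  have J: "J \<subseteq> pairs n" "J \<subseteq> Z'" "Z \<inter> J = {}" "finite J"
    using u by (auto simp: J_def Z'_def Z_def touching_def pairs_def fresh_def u_def[symmetric] card_insert_if)
  have disc: "card (discovered n F s) = card (F \<inter> J)" for F
  proof -
    have "F \<inter> J = (\<lambda>x. {u, x}) ` discovered n F s" by (auto simp: J_def discovered_def u_def)
    moreover have "inj_on (\<lambda>x. {u, x}) (discovered n F s)"
      using inj by (rule inj_on_subset) (auto simp: discovered_def)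
    ultimately show ?thesis by (simp add: card_image)
  qed
  have ZZ': "Z \<subseteq> Z'" by (auto simp: Z_def Z'_def touching_def)
  let ?f = "\<lambda>t s F. w ^ found n F t s * (1 / r) ^ queries n F t s * \<phi> (explore n F t s) F"
  have "(\<Sum>F\<in>cyl n Z B. m F * ?f (Suc t) s F)
     \<le> (\<Sum>F\<in>cyl n Z B. m F * (\<kappa> * (1 / r) ^ card J * w ^ card (F \<inter> J)))"
  proof (rule sum_cyl_mono[OF ZZ'])
    fix B'
    show "(\<Sum>F\<in>cyl n Z' B'. m F * ?f (Suc t) s F)
       \<le> (\<Sum>F\<in>cyl n Z' B'. m F * (\<kappa> * (1 / r) ^ card J * w ^ card (F \<inter> J)))"
    proof (cases "cyl n Z' B' = {}")
      case False
      then obtain F0 where F0: "F0 \<in> cyl n Z' B'" by auto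
      define s' where "s' = step n F0 s"
      have FJ: "F \<inter> J = B' \<inter> J" if "F \<in> cyl n Z' B'" for F
        using that J(2) by (auto simp: cyl_def)
      \<comment> \<open>On a cylinder over \<open>Z'\<close> all edges at \<open>u\<close> are
        known, so the first step leads to one and the same state, to which the induction hypothesis
        applies.\<close>
      have st: "step n F s = s'" if "F \<in> cyl n Z' B'" for F
      proof -
        have "{u, x} \<in> F \<longleftrightarrow> {u, x} \<in> F0" if "x \<in> fresh n s" for x
        proof -
          have "{u, x} \<in> J" using that by (simp add: J_def)
          then show ?thesis using FJ[OF \<open>F \<in> cyl n Z' B'\<close>] FJ[OF F0] by blast
        qed
        then have "discovered n F s = discovered n F0 s"
          by (auto simp: discovered_def u_def[symmetric])
        then show ?thesis by (simp add: s'_def step_def)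
      qed
      have s': "valid n s'" "card (fst s') = Suc (card (fst s))"
        unfolding s'_def using valid_step[OF Suc.prems(1) lt] by auto
      have Z'_eq: "Z' = touching n (fst s')" by (simp add: Z'_def s'_def step_def u_def)
      define k where "k = w ^ card (B' \<inter> J) * (1 / r) ^ card J"
      have k: "0 \<le> k" using w r by (simp add: k_def)
      have "(\<Sum>F\<in>cyl n Z' B'. m F * ?f (Suc t) s F) = (\<Sum>F\<in>cyl n Z' B'. k * (m F * ?f t s' F))"
      proof (intro sum.cong refl)
        fix F assume F: "F \<in> cyl n Z' B'"
        show "m F * ?f (Suc t) s F = k * (m F * ?f t s' F)"
          unfolding found_Suc' queries_Suc' explore_Suc' disc st[OF F] k_def FJ[OF F] cJ power_add
          by (simp only: mult_ac)
      qed
      also have "\<dots> = k * (\<Sum>F\<in>cyl n Z' B'. m F * ?f t s' F)" by (simp add: sum_distrib_left)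
      also have "\<dots> \<le> k * (\<kappa> * sum m (cyl n Z' B'))"
      proof (intro mult_left_mono k)
        show "(\<Sum>F\<in>cyl n Z' B'. m F * ?f t s' F) \<le> \<kappa> * sum m (cyl n Z' B')"
          unfolding Z'_eq using Suc.prems s' by (intro Suc.IH) auto
      qed
      also have "\<dots> = (\<Sum>F\<in>cyl n Z' B'. m F * (\<kappa> * (1 / r) ^ card J * w ^ card (F \<inter> J)))"
        by (simp add: sum_distrib_left sum_distrib_right k_def FJ mult_ac)
      finally show ?thesis .
    qed simp
  qed
  also have "\<dots> = \<kappa> * (1 / r) ^ card J * (\<Sum>F\<in>cyl n Z B. m F * w ^ card (F \<inter> J))"
    by (simp add: sum_distrib_left mult_ac)
  \<comment> \<open>Only now is the first step averaged, given \<open>Z\<close> alone. Its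
    \<open>card J\<close> tests contribute at most \<open>r ^ card J\<close>, which the
    normalisation cancels.\<close>
  also have "\<dots> \<le> \<kappa> * (1 / r) ^ card J * (r ^ card J * sum m (cyl n Z B))"
  proof (intro mult_left_mono tilted_multi[OF tilt w] J)
    have "card (Z \<union> J) \<le> card Z'"
      using ZZ' J finite_subset[OF touching_subset finite_pairs] by (intro card_mono) (auto simp: Z'_def)
    also have "\<dots> \<le> card (insert u (fst s)) * n"
      unfolding Z'_def using u Suc.prems by (intro card_touching) (auto simp: valid_def)
    also have "\<dots> \<le> (card (fst s) + Suc t) * n"
      using valid_finite[OF Suc.prems(1)] by (intro mult_le_mono) (auto simp: card_insert_if)
    finally have "card (Z \<union> J) \<le> K" using Suc.prems by simp
    moreover have "card (Z \<union> J) = card Z + card J"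
      using J finite_subset[OF touching_subset finite_pairs] by (intro card_Un_disjoint) (auto simp: Z_def)
    ultimately show "card Z + card J \<le> K" by simp
  qed (use \<kappa> r touching_subset in \<open>auto simp: Z_def\<close>)
  also have "\<dots> = \<kappa> * sum m (cyl n Z B)"
    using r by (simp add: power_one_over)
  finally show ?case by (simp add: Z_def)
qed

text \<open>Markov's inequality for the supermartingale with \<open>w \<le> 1\<close>. Few active
  vertices at time \<open>t\<close> mean few discoveries by \<open>found_le_active\<close> and many
  queries by \<open>queries_ge\<close>, and both make the supermartingale large.\<close>

lemma few_active_bound:
  assumes tilt: "tilted n m K w r" and w: "0 < w" "w \<le> 1" and r: "0 < r" "r \<le> 1" and m: "\<And>F. 0 \<le> m F"
    and s: "valid n s" "card (fst s) + t \<le> n" "(card (fst s) + t) * n \<le> K"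
  shows "(\<Sum>F\<in>cyl n (touching n (fst s)) B. m F * of_bool (card (snd (explore n F t s)) < a))
    \<le> r ^ (t * (n - (card (fst s) + t + a))) / w ^ (a + t) * sum m (cyl n (touching n (fst s)) B)"
proof -
  define q where "q = t * (n - (card (fst s) + t + a))"
  let ?C = "cyl n (touching n (fst s)) B"
  let ?f = "\<lambda>F. w ^ found n F t s * (1 / r) ^ queries n F t s * 1"
  have pt: "of_bool (card (snd (explore n F t s)) < a) \<le> r ^ q / w ^ (a + t) * ?f F" for F
  proof (cases "card (snd (explore n F t s)) < a")
    case True
    have "found n F t s \<le> a + t" using found_le_active[OF s(1,2), of F] True by simp
    then have 1: "w ^ (a + t) \<le> w ^ found n F t s" using w by (intro power_decreasing) auto
    have "q \<le> t * (n - (card (fst s) + t + card (snd (explore n F t s))))"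
      unfolding q_def using True by (intro mult_le_mono) auto
    also have "\<dots> \<le> queries n F t s" by (rule queries_ge[OF s(1,2)])
    finally have 2: "(1 / r) ^ q \<le> (1 / r) ^ queries n F t s" using r by (intro power_increasing) auto
    have "1 = r ^ q / w ^ (a + t) * (w ^ (a + t) * (1 / r) ^ q)" using w r by (simp add: power_one_over)
    also have "\<dots> \<le> r ^ q / w ^ (a + t) * ?f F"
      using 1 2 w r by (simp only: mult_1_right) (intro mult_left_mono mult_mono, auto)
    finally show ?thesis by simp
  qed (use w r in auto)
  have "(\<Sum>F\<in>?C. m F * of_bool (card (snd (explore n F t s)) < a)) \<le> (\<Sum>F\<in>?C. m F * (r ^ q / w ^ (a + t) * ?f F))"
    using m pt by (intro sum_mono mult_left_mono) auto
  also have "\<dots> = r ^ q / w ^ (a + t) * (\<Sum>F\<in>?C. m F * ?f F)"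
    by (simp add: sum_distrib_left mult_ac)
  also have "\<dots> \<le> r ^ q / w ^ (a + t) * (1 * sum m ?C)"
    using s w r m by (intro mult_left_mono explore_bound[OF tilt]) auto
  finally show ?thesis by (simp add: q_def)
qed

text \<open>The opposite tail, with \<open>w \<ge> 1\<close>. As \<open>r \<ge> 1\<close>, it is an
  upper bound on the number of queries that keeps the supermartingale large.\<close>

lemma many_found_bound:
  assumes tilt: "tilted n m K w r" and w: "1 \<le> w" and r: "1 \<le> r" and m: "\<And>F. 0 \<le> m F"
    and s: "valid n s" "card (fst s) + t \<le> n" "(card (fst s) + t) * n \<le> K"
  shows "(\<Sum>F\<in>cyl n (touching n (fst s)) B. m F * of_bool (k \<le> found n F t s))
    \<le> r ^ (t * n) / w ^ k * sum m (cyl n (touching n (fst s)) B)"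
proof -
  let ?C = "cyl n (touching n (fst s)) B"
  let ?f = "\<lambda>F. w ^ found n F t s * (1 / r) ^ queries n F t s * 1"
  have pt: "of_bool (k \<le> found n F t s) \<le> r ^ (t * n) / w ^ k * ?f F" for F
  proof (cases "k \<le> found n F t s")
    case True
    then have 1: "w ^ k \<le> w ^ found n F t s" using w by (intro power_increasing) auto
    have 2: "(1 / r) ^ (t * n) \<le> (1 / r) ^ queries n F t s"
      using r queries_le by (intro power_decreasing) auto
    have "1 = r ^ (t * n) / w ^ k * (w ^ k * (1 / r) ^ (t * n))" using w r by (simp add: power_one_over)
    also have "\<dots> \<le> r ^ (t * n) / w ^ k * ?f F"
      using 1 2 w r by (simp only: mult_1_right) (intro mult_left_mono mult_mono, auto)
    finally show ?thesis by simp
  qed (use w r in auto)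
  have "(\<Sum>F\<in>?C. m F * of_bool (k \<le> found n F t s)) \<le> (\<Sum>F\<in>?C. m F * (r ^ (t * n) / w ^ k * ?f F))"
    using m pt by (intro sum_mono mult_left_mono) auto
  also have "\<dots> = r ^ (t * n) / w ^ k * (\<Sum>F\<in>?C. m F * ?f F)"
    by (simp add: sum_distrib_left mult_ac)
  also have "\<dots> \<le> r ^ (t * n) / w ^ k * (1 * sum m ?C)"
    using s w r m by (intro mult_left_mono explore_bound[OF tilt]) auto
  finally show ?thesis by simp
qed

text \<open>At \<open>w = 0\<close> the weight \<open>0 ^ card (F \<inter> J)\<close> is the
  indicator of having no edge in \<open>J\<close>, because \<open>0 ^ 0 = 1\<close>.\<close>

lemma no_edges_bound:
  assumes tilt: "tilted n m K 0 r" and r: "0 \<le> r" and m: "\<And>F. 0 \<le> m F"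
    and "D \<subseteq> {1..n}" "X \<subseteq> {1..n} - D" "Y \<subseteq> {1..n} - D" "X \<inter> Y = {}"
    and "a \<le> card X" "a \<le> card Y" "card D * n + a * a \<le> K"
  shows "(\<Sum>F\<in>cyl n (touching n D) B. m F * of_bool (\<forall>x\<in>X. \<forall>y\<in>Y. {x, y} \<notin> F))
    \<le> r ^ (a * a) * sum m (cyl n (touching n D) B)"
proof -
  \<comment> \<open>Shrinking both sides to exactly \<open>a\<close> vertices keeps the number of
    further exposed pairs at \<open>a * a\<close>, within the allowance \<open>K\<close>.\<close>
  obtain X' where X': "X' \<subseteq> X" "card X' = a" "finite X'"
    using obtain_subset_with_card_n[OF assms(8)] by metis
  obtain Y' where Y': "Y' \<subseteq> Y" "card Y' = a" "finite Y'"
    using obtain_subset_with_card_n[OF assms(9)] by metis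
  define J where "J = (\<lambda>(x, y). {x, y}) ` (X' \<times> Y')"
  have inj: "inj_on (\<lambda>(x, y). {x, y}) (X' \<times> Y')"
    using X' Y' assms(7) by (fastforce simp: inj_on_def doubleton_eq_iff)
  have "X' \<inter> Y' = {}" using X' Y' assms(7) by auto
  then have J: "finite J" "J \<subseteq> pairs n" "touching n D \<inter> J = {}" "card J = a * a"
    using X' Y' assms(5-7) inj unfolding J_def
    by (auto simp: card_image card_cartesian_product pairs_def touching_def card_insert_if)
  let ?C = "cyl n (touching n D) B"
  have "(\<Sum>F\<in>?C. m F * of_bool (\<forall>x\<in>X. \<forall>y\<in>Y. {x, y} \<notin> F)) \<le> (\<Sum>F\<in>?C. m F * 0 ^ card (F \<inter> J))"
  proof (intro sum_mono mult_left_mono m)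
    fix F
    show "of_bool (\<forall>x\<in>X. \<forall>y\<in>Y. {x, y} \<notin> F) \<le> (0 :: real) ^ card (F \<inter> J)"
    proof (cases "\<forall>x\<in>X. \<forall>y\<in>Y. {x, y} \<notin> F")
      case True
      then have "F \<inter> J = {}" using X' Y' by (auto simp: J_def)
      then show ?thesis by simp
    qed auto
  qed
  also have "\<dots> \<le> r ^ card J * sum m ?C"
    using card_touching[OF assms(4)] assms(10) J r touching_subset
    by (intro tilted_multi[OF tilt]) auto
  finally show ?thesis using J by simp
qed

section \<open>Components\<close>

abbreviation joined :: "nat set set \<Rightarrow> (nat \<times> nat) set" where
  "joined F \<equiv> {(u, v). {u, v} \<in> F}\<^sup>*"

lemma joined_sym: "(u, v) \<in> joined F \<Longrightarrow> (v, u) \<in> joined F"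
proof -
  have "sym {(u, v). {u, v} \<in> F}" by (auto simp: sym_def insert_commute)
  then show "(u, v) \<in> joined F \<Longrightarrow> (v, u) \<in> joined F" by (blast dest: sym_rtrancl symD)
qed

lemma joined_Image_eq: "(u, v) \<in> joined F \<Longrightarrow> joined F `` {u} = joined F `` {v}"
  using joined_sym[of u v F] by (auto intro: rtrancl_trans)

lemma joined_disjoint: "joined F `` {u} \<noteq> joined F `` {v} \<Longrightarrow> joined F `` {u} \<inter> joined F `` {v} = {}"
  using joined_Image_eq by (metis (no_types, lifting) disjoint_iff Image_singleton_iff)

lemma joined_subset:
  assumes "F \<subseteq> pairs n" "v \<in> {1..n}"
  shows "joined F `` {v} \<subseteq> {1..n}"
proof
  fix x assume "x \<in> joined F `` {v}"
  then have "(v, x) \<in> joined F" by simp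
  then show "x \<in> {1..n}"
    using assms by (induction rule: rtrancl_induct) (auto simp: pairs_def)
qed

lemma components_eq: "components n F = (\<lambda>v. joined F `` {v}) ` {1..n}"
  by (auto simp: components_def quotient_def)

text \<open>While \<open>j < card C\<close> there is always an active vertex in \<open>C\<close>, so
  no restart happens and every step consumes exactly one active vertex. This sharpens
  \<open>found_le_active\<close> to an equation, in which \<open>Suc\<close> accounts for the start
  vertex. The set \<open>D\<close> has been explored before and is disjoint from \<open>C\<close>,
  so avoiding it loses no vertex of \<open>C\<close>.\<close>

lemma explore_in_component:
  fixes v :: nat
  assumes F: "F \<subseteq> pairs n" and v: "valid n (D, {v})"
  defines "C \<equiv> joined F `` {v}"
  assumes D: "D \<inter> C = {}" and t: "t < card C" and jt: "j \<le> t"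
  shows "D \<subseteq> fst (explore n F j (D, {v})) \<and> fst (explore n F j (D, {v})) - D \<subseteq> C
    \<and> snd (explore n F j (D, {v})) \<subseteq> C \<and> snd (explore n F j (D, {v})) \<noteq> {}
    \<and> v \<in> fst (explore n F j (D, {v})) \<union> snd (explore n F j (D, {v}))
    \<and> (\<forall>x\<in>fst (explore n F j (D, {v})) - D. \<forall>y. {x, y} \<in> F \<longrightarrow>
        y \<in> (fst (explore n F j (D, {v})) - D) \<union> snd (explore n F j (D, {v})))
    \<and> card (snd (explore n F j (D, {v}))) + j = Suc (found n F j (D, {v}))"
  using jt
proof (induction j)
  case 0
  then show ?case by (auto simp: C_def)
next
  case (Suc j)
  define s where "s = explore n F j (D, {v})"
  define u where "u = next_vertex n s"
  have CV: "C \<subseteq> {1..n}" unfolding C_def using v by (intro joined_subset[OF F]) (auto simp: valid_def)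
  have finD: "finite D" using valid_finite[OF v] by simp
  have "card D + card C = card (D \<union> C)"
    using D finD CV finite_subset by (intro card_Un_disjoint[symmetric]) auto
  also have "\<dots> \<le> card {1..n}" using CV v by (intro card_mono) (auto simp: valid_def)
  finally have DC: "card D + card C \<le> n" by simp
  have vs: "valid n s" "card (fst s) = card D + j"
    unfolding s_def using valid_explore[OF v, of j F] DC Suc.prems t by auto
  have fin: "finite (fst s)" "finite (snd s)" using valid_finite[OF vs(1)] by auto
  have lt: "card (fst s) < n" using vs DC Suc.prems t by simp
  have IH: "D \<subseteq> fst s" "fst s - D \<subseteq> C" "snd s \<subseteq> C" "snd s \<noteq> {}" "v \<in> fst s \<union> snd s"
    "\<And>x y. x \<in> fst s - D \<Longrightarrow> {x, y} \<in> F \<Longrightarrow> y \<in> (fst s - D) \<union> snd s"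
    "card (snd s) + j = Suc (found n F j (D, {v}))"
    using Suc.IH Suc.prems unfolding s_def by auto
  have u: "u \<in> snd s" "u \<notin> fst s" "u \<in> {1..n}" using next_vertex_in[OF vs(1) lt] IH(4) by (auto simp: u_def)
  have nb: "y \<in> C" if "{u, y} \<in> F" for y
  proof -
    have "(v, u) \<in> joined F" using u IH(3) by (auto simp: C_def)
    then have "(v, y) \<in> joined F" using that by (auto intro: rtrancl_into_rtrancl)
    then show ?thesis by (simp add: C_def)
  qed
  have nb': "y \<in> (insert u (fst s) - D) \<union> (snd s - {u} \<union> discovered n F s)" if "{u, y} \<in> F" for y
  proof -
    have "y \<in> {1..n}" "y \<notin> D" using nb[OF that] CV D by auto
    then show ?thesis using that by (auto simp: discovered_def fresh_def u_def)
  qed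
  define s' where "s' = explore n F (Suc j) (D, {v})"
  have s': "s' = (insert u (fst s), snd s - {u} \<union> discovered n F s)"
    by (simp add: s'_def explore_Suc step_def s_def u_def)
  have 1: "D \<subseteq> fst s'" "fst s' - D \<subseteq> C" using IH u by (auto simp: s')
  have 2: "snd s' \<subseteq> C" using IH nb by (auto simp: s' discovered_def u_def)
  have 3: "v \<in> fst s' \<union> snd s'" using IH by (auto simp: s')
  have 4: "y \<in> (fst s' - D) \<union> snd s'" if "x \<in> fst s' - D" "{x, y} \<in> F" for x y
  proof (cases "x = u")
    case True
    then show ?thesis using nb'[of y] that by (simp add: s')
  next
    case False
    then have "x \<in> fst s - D" using that by (auto simp: s')
    then have "y \<in> (fst s - D) \<union> snd s" using IH(6) that by blast
    moreover have "u \<notin> D" using u IH(3) D by auto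
    ultimately show ?thesis by (auto simp: s')
  qed
  \<comment> \<open>Without active vertices, the newly explored set would contain \<open>v\<close>
    and be closed under adjacency, hence contain \<open>C\<close>; but it has only
    \<open>Suc j \<le> t < card C\<close> elements.\<close>
  have 5: "snd s' \<noteq> {}"
  proof
    assume e: "snd s' = {}"
    have "x \<in> fst s' - D" if "(v, x) \<in> joined F" for x
      using that
    proof (induction rule: rtrancl_induct)
      case base
      then show ?case using 3 e D by (auto simp: C_def)
    next
      case (step y z)
      then show ?case using 4[of y z] e by auto
    qed
    then have "C \<subseteq> fst s' - D" by (auto simp: C_def)
    then have "card C \<le> card (fst s' - D)" using fin by (intro card_mono) (auto simp: s')
    also have "\<dots> = card (fst s') - card D" using finD 1 by (intro card_Diff_subset) auto
    also have "\<dots> = Suc j" using vs fin u by (simp add: s')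
    finally show False using Suc.prems t by simp
  qed
  have "card (snd s') = card (snd s - {u}) + card (discovered n F s)"
    unfolding s' using fin by simp (intro card_Un_disjoint, auto simp: discovered_def fresh_def)
  moreover have "Suc (card (snd s - {u})) = card (snd s)"
    using u fin by (metis card_Suc_Diff1)
  moreover have "found n F (Suc j) (D, {v}) = found n F j (D, {v}) + card (discovered n F s)"
    by (simp add: found_Suc s_def)
  ultimately have 6: "card (snd s') + Suc j = Suc (found n F (Suc j) (D, {v}))" using IH(7) by simp
  show ?case unfolding s'_def[symmetric] using 1 2 3 4 5 6 by blast
qed

text \<open>A restart happens only when nothing is active, so all active vertices descend from the
  most recent starting vertex. The existence of a large component rests on this.\<close>

lemma explore_active_connected:
  assumes F: "F \<subseteq> pairs n" and "t \<le> n" "1 \<le> n"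
  shows "\<exists>v\<in>{1..n}. snd (explore n F t ({}, {})) \<subseteq> joined F `` {v}"
  using assms(2)
proof (induction t)
  case 0
  then show ?case using \<open>1 \<le> n\<close> by (auto intro!: bexI[of _ 1])
next
  case (Suc t)
  define s where "s = explore n F t ({}, {})"
  define u where "u = next_vertex n s"
  have vs: "valid n s" "card (fst s) < n"
    unfolding s_def using valid_explore[of n "({}, {})" t F] Suc.prems by (auto simp: valid_def)
  note u = next_vertex_in[OF vs, folded u_def]
  obtain v where v: "v \<in> {1..n}" "snd s \<subseteq> joined F `` {v}" using Suc by (auto simp: s_def)
  have s': "snd (explore n F (Suc t) ({}, {})) = snd s - {u} \<union> discovered n F s"
    by (simp add: explore_Suc step_def s_def u_def)
  have d: "(u, x) \<in> joined F" if "x \<in> discovered n F s" for x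
    using that by (auto simp: discovered_def u_def)
  show ?case
  proof (cases "snd s = {}")
    case True
    then show ?thesis using u d s' by (intro bexI[of _ u]) auto
  next
    case False
    then have "(v, u) \<in> joined F" using u v by auto
    then show ?thesis using v d s' by (intro bexI[of _ v]) (auto intro: rtrancl_trans)
  qed
qed

section \<open>Bounds for the component sizes\<close>

text \<open>Disjointness from \<open>fst s'\<close> as well as \<open>snd s'\<close> guarantees, for
  valid \<open>s'\<close>, that no pair between the two active sets touches an explored vertex. All
  these pairs are then still unexposed after both explorations.\<close>

definition clash :: "nat \<Rightarrow> state \<Rightarrow> state \<Rightarrow> nat set set \<Rightarrow> bool" where
  "clash a s s' F \<longleftrightarrow> a \<le> card (snd s) \<and> a \<le> card (snd s') \<and> snd s \<inter> (fst s' \<union> snd s') = {} \<and>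
     (\<forall>x\<in>snd s. \<forall>y\<in>snd s'. {x, y} \<notin> F)"

text \<open>The second exploration starts at \<open>x\<close> and avoids the vertices explored by the first one.\<close>

definition separated :: "nat \<Rightarrow> nat \<Rightarrow> nat \<Rightarrow> nat \<Rightarrow> nat \<Rightarrow> nat set set \<Rightarrow> bool" where
  "separated n t a v x F \<longleftrightarrow> (let s = explore n F t ({}, {v}); s' = explore n F t (fst s, {x}) in
     card (snd s) < a \<or> (x \<notin> fst s \<and> card (snd s') < a) \<or> (x \<notin> fst s \<and> clash a s s' F))"

text \<open>A union bound over the three ways of being separated. The second exploration is
  controlled conditionally on the first, and the clash conditionally on both.\<close>

lemma separated_bound:
  assumes tilt: "tilted n m K w r" and tilt0: "tilted n m K 0 q"
    and w: "0 < w" "w \<le> 1" and r: "0 < r" "r \<le> 1" and q: "0 \<le> q"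
    and m: "\<And>F. 0 \<le> m F" "sum m (Pow (pairs n)) = 1"
    and vx: "v \<in> {1..n}" "x \<in> {1..n}" and t: "2 * t \<le> n" and K: "2 * t * n + a * a \<le> K"
  defines "c \<equiv> r ^ (t * (n - (2 * t + a))) / w ^ (a + t)"
  shows "(\<Sum>F\<in>Pow (pairs n). m F * of_bool (separated n t a v x F)) \<le> 2 * c + q ^ (a * a)"
proof -
  have P: "cyl n (touching n {}) {} = Pow (pairs n)" by (auto simp: cyl_def touching_def)
  have c: "0 \<le> c" using w r by (simp add: c_def)
  define s1 where "s1 = (\<lambda>F. explore n F t ({}, {v}))"
  define s2 where "s2 = (\<lambda>F (s :: state). explore n F t (fst s, {x}))"
  have valid_x: "valid n (fst s, {x})" if "valid n s" "x \<notin> fst s" for s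
    using that vx by (auto simp: valid_def)
  have v0: "valid n ({}, {v})" using vx by (auto simp: valid_def)
  have Kt: "t * n \<le> K" "(t + t) * n \<le> K" "(t + t) * n + a * a \<le> K"
    using K by (auto simp: algebra_simps)
  have 1: "(\<Sum>F\<in>Pow (pairs n). m F * of_bool (card (snd (s1 F)) < a)) \<le> c"
  proof -
    have "(\<Sum>F\<in>Pow (pairs n). m F * of_bool (card (snd (s1 F)) < a))
        \<le> r ^ (t * (n - (t + a))) / w ^ (a + t)"
      using few_active_bound[OF tilt w r m(1) v0, of t a "{}"] t Kt m(2) by (simp add: P s1_def)
    also have "\<dots> \<le> c"
      unfolding c_def using r w by (intro divide_right_mono power_decreasing mult_le_mono) auto
    finally show ?thesis .
  qed
  \<comment> \<open>Strong Markov property at the end of the first exploration. The second one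
    starts with \<open>t\<close> explored vertices, whence \<open>2 * t\<close> in the exponent of
    \<open>c\<close>.\<close>
  have 2: "(\<Sum>F\<in>Pow (pairs n). m F * of_bool (x \<notin> fst (s1 F) \<and> card (snd (s2 F (s1 F))) < a)) \<le> c"
  proof -
    let ?\<phi> = "\<lambda>s F. of_bool (x \<notin> fst s \<and> card (snd (s2 F s)) < a) :: real"
    have "(\<Sum>F\<in>cyl n (touching n (fst ({}, {v}))) {}.
        m F * (1 ^ found n F t ({}, {v}) * (1 / 1) ^ queries n F t ({}, {v}) * ?\<phi> (explore n F t ({}, {v})) F))
      \<le> c * sum m (cyl n (touching n (fst ({}, {v}))) {})"
    proof (rule explore_bound[OF tilted_1])
      fix s' B' assume s': "valid n s'" "card (fst s') = card (fst ({} :: nat set, {v})) + t"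
      show "(\<Sum>F\<in>cyl n (touching n (fst s')) B'. m F * ?\<phi> s' F) \<le> c * sum m (cyl n (touching n (fst s')) B')"
      proof (cases "x \<in> fst s'")
        case True
        then show ?thesis using c m by (simp add: sum_nonneg)
      next
        case False
        then have "(\<Sum>F\<in>cyl n (touching n (fst s')) B'. m F * ?\<phi> s' F)
           \<le> r ^ (t * (n - (t + t + a))) / w ^ (a + t) * sum m (cyl n (touching n (fst s')) B')"
          using few_active_bound[OF tilt w r m(1) valid_x[OF s'(1)], of t a B'] s' Kt t
          by (simp add: s2_def)
        then show ?thesis by (simp add: c_def mult_2)
      qed
    qed (use v0 t Kt m c in auto)
    then show ?thesis using m by (simp add: P s1_def)
  qed
  have 3: "(\<Sum>F\<in>Pow (pairs n). m F * of_bool (x \<notin> fst (s1 F) \<and> clash a (s1 F) (s2 F (s1 F)) F)) \<le> q ^ (a * a)"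
  proof -
    let ?\<phi> = "\<lambda>s F. of_bool (x \<notin> fst s \<and> clash a s (s2 F s) F) :: real"
    have "(\<Sum>F\<in>cyl n (touching n (fst ({}, {v}))) {}.
        m F * (1 ^ found n F t ({}, {v}) * (1 / 1) ^ queries n F t ({}, {v}) * ?\<phi> (explore n F t ({}, {v})) F))
      \<le> q ^ (a * a) * sum m (cyl n (touching n (fst ({}, {v}))) {})"
    proof (rule explore_bound[OF tilted_1])
      fix s' B' assume s': "valid n s'" "card (fst s') = card (fst ({} :: nat set, {v})) + t"
      show "(\<Sum>F\<in>cyl n (touching n (fst s')) B'. m F * ?\<phi> s' F)
        \<le> q ^ (a * a) * sum m (cyl n (touching n (fst s')) B')"
      proof (cases "x \<in> fst s'")
        case True
        then show ?thesis using q m by (simp add: sum_nonneg)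
      next
        case False
        let ?z = "(fst s', {x})"
        have "(\<Sum>F\<in>cyl n (touching n (fst ?z)) B'.
            m F * (1 ^ found n F t ?z * (1 / 1) ^ queries n F t ?z * of_bool (clash a s' (explore n F t ?z) F)))
          \<le> q ^ (a * a) * sum m (cyl n (touching n (fst ?z)) B')"
        \<comment> \<open>The strong Markov property is used a second time, at the end of the second
          exploration, with the first state \<open>s'\<close> frozen.\<close>
        proof (rule explore_bound[OF tilted_1, where \<phi> = "\<lambda>s F. of_bool (clash a s' s F)"])
          fix s'' B'' assume s'': "valid n s''" "card (fst s'') = card (fst ?z) + t"
          let ?C = "cyl n (touching n (fst s'')) B''"
          show "(\<Sum>F\<in>?C. m F * of_bool (clash a s' s'' F)) \<le> q ^ (a * a) * sum m ?C"
          proof (cases "a \<le> card (snd s') \<and> a \<le> card (snd s'') \<and> snd s' \<inter> (fst s'' \<union> snd s'') = {}")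
            case True
            then have "(\<Sum>F\<in>?C. m F * of_bool (\<forall>x\<in>snd s'. \<forall>y\<in>snd s''. {x, y} \<notin> F)) \<le> q ^ (a * a) * sum m ?C"
              using s' s'' Kt by (intro no_edges_bound[OF tilt0 q m(1)]) (auto simp: valid_def)
            then show ?thesis using True by (simp add: clash_def)
          next
            case False
            then have "\<not> clash a s' s'' F" for F by (auto simp: clash_def)
            then show ?thesis using q m by (simp add: sum_nonneg)
          qed
        qed (use valid_x[OF s'(1) False] s' t Kt m q in auto)
        then show ?thesis using False by (simp add: s2_def)
      qed
    qed (use v0 t Kt m q in auto)
    then show ?thesis using m by (simp add: P s1_def)
  qed
  have "(\<Sum>F\<in>Pow (pairs n). m F * of_bool (separated n t a v x F))
    \<le> (\<Sum>F\<in>Pow (pairs n). m F * of_bool (card (snd (s1 F)) < a)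
        + m F * of_bool (x \<notin> fst (s1 F) \<and> card (snd (s2 F (s1 F))) < a)
        + m F * of_bool (x \<notin> fst (s1 F) \<and> clash a (s1 F) (s2 F (s1 F)) F))"
    using m(1) by (intro sum_mono) (auto simp: separated_def Let_def s1_def s2_def)
  also have "\<dots> \<le> c + c + q ^ (a * a)"
    using 1 2 3 by (simp add: sum.distrib)
  finally show ?thesis by simp
qed

text \<open>Explorations started in different large components stay inside them, so their active
  sets are disjoint and not joined by any edge: either one of them is small or they clash.\<close>

lemma separatedI:
  assumes F: "F \<subseteq> pairs n" and vx: "v \<in> {1..n}" "x \<in> {1..n}"
    and ne: "joined F `` {v} \<noteq> joined F `` {x}"
    and t: "t < card (joined F `` {v})" "t < card (joined F `` {x})"
  shows "separated n t a v x F"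
proof -
  define s where "s = explore n F t ({}, {v})"
  define s' where "s' = explore n F t (fst s, {x})"
  have v: "valid n ({}, {v})" using vx by (auto simp: valid_def)
  have disj: "joined F `` {v} \<inter> joined F `` {x} = {}" using joined_disjoint[OF ne] .
  have s: "fst s \<subseteq> joined F `` {v}" "snd s \<subseteq> joined F `` {v}"
    using explore_in_component[OF F v _ t(1) order_refl] by (auto simp: s_def)
  have "card (joined F `` {v}) \<le> card {1..n}"
    using joined_subset[OF F vx(1)] by (intro card_mono) auto
  then have vs: "valid n s" unfolding s_def using t by (intro valid_explore[OF v]) auto
  have x: "x \<notin> fst s" using s disj by auto
  have vx': "valid n (fst s, {x})" using vs x vx by (auto simp: valid_def)
  have s': "fst s \<subseteq> fst s'" "fst s' - fst s \<subseteq> joined F `` {x}" "snd s' \<subseteq> joined F `` {x}"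
  proof -
    have "fst s \<inter> joined F `` {x} = {}" using s disj by blast
    then show "fst s \<subseteq> fst s'" "fst s' - fst s \<subseteq> joined F `` {x}" "snd s' \<subseteq> joined F `` {x}"
      using explore_in_component[OF F vx' _ t(2) order_refl] unfolding s'_def by blast+
  qed
  have "{y, z} \<notin> F" if "y \<in> snd s" "z \<in> snd s'" for y z
  proof
    assume "{y, z} \<in> F"
    then have "(v, z) \<in> joined F" using that(1) s by (auto intro: rtrancl_into_rtrancl)
    then show False using that(2) s' disj by auto
  qed
  moreover have "snd s \<inter> (fst s' \<union> snd s') = {}"
  proof -
    have "snd s \<inter> fst s = {}" using vs by (auto simp: valid_def)
    then show ?thesis using s s' disj by blast
  qed
  ultimately have "a \<le> card (snd s) \<Longrightarrow> a \<le> card (snd s') \<Longrightarrow> clash a s s' F"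
    unfolding clash_def by blast
  then have "card (snd s) < a \<or> x \<notin> fst s \<and> card (snd s') < a \<or> x \<notin> fst s \<and> clash a s s' F"
    using x by (meson not_le)
  then show ?thesis unfolding separated_def Let_def s_def s'_def .
qed

text \<open>By \<open>separatedI\<close>, a union bound over the pairs of starting vertices
  suffices.\<close>

lemma two_large_components_bound:
  assumes "tilted n m K w r" "tilted n m K 0 q"
    and "0 < w" "w \<le> 1" "0 < r" "r \<le> 1" "0 \<le> q"
    and m: "\<And>F. 0 \<le> m F" and "sum m (Pow (pairs n)) = 1"
    and "2 * t \<le> n" "2 * t * n + a * a \<le> K"
  shows "(\<Sum>F\<in>Pow (pairs n). m F *
      of_bool (\<exists>C\<in>components n F. \<exists>C'\<in>components n F. C \<noteq> C' \<and> t < card C \<and> t < card C'))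
    \<le> real n ^ 2 * (2 * (r ^ (t * (n - (2 * t + a))) / w ^ (a + t)) + q ^ (a * a))"
proof -
  let ?V = "{1..n} \<times> {1..n}"
  have "(\<Sum>F\<in>Pow (pairs n). m F *
      of_bool (\<exists>C\<in>components n F. \<exists>C'\<in>components n F. C \<noteq> C' \<and> t < card C \<and> t < card C'))
    \<le> (\<Sum>F\<in>Pow (pairs n). m F * (\<Sum>(v, x)\<in>?V. of_bool (separated n t a v x F)))"
  proof (intro sum_mono mult_left_mono m)
    fix F assume F: "F \<in> Pow (pairs n)"
    show "of_bool (\<exists>C\<in>components n F. \<exists>C'\<in>components n F. C \<noteq> C' \<and> t < card C \<and> t < card C')
      \<le> (\<Sum>(v, x)\<in>?V. of_bool (separated n t a v x F) :: real)"
    proof (cases "\<exists>C\<in>components n F. \<exists>C'\<in>components n F. C \<noteq> C' \<and> t < card C \<and> t < card C'")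
      case True
      then obtain v x where vx: "v \<in> {1..n}" "x \<in> {1..n}" "separated n t a v x F"
        using F separatedI[of F n _ _ t a] unfolding components_eq by blast
      have "(1 :: real) = (\<Sum>(v, x)\<in>{(v, x)}. of_bool (separated n t a v x F))" using vx by simp
      also have "\<dots> \<le> (\<Sum>(v, x)\<in>?V. of_bool (separated n t a v x F))"
        using vx by (intro sum_mono2) auto
      finally show ?thesis using True by simp
    qed (auto intro!: sum_nonneg)
  qed
  also have "\<dots> = (\<Sum>(v, x)\<in>?V. \<Sum>F\<in>Pow (pairs n). m F * of_bool (separated n t a v x F))"
    unfolding case_prod_unfold sum_distrib_left by (rule sum.swap)
  also have "\<dots> \<le> (\<Sum>(v, x)\<in>?V. 2 * (r ^ (t * (n - (2 * t + a))) / w ^ (a + t)) + q ^ (a * a))"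
  proof (intro sum_mono)
    fix y assume y: "y \<in> ?V"
    show "(case y of (v, x) \<Rightarrow> \<Sum>F\<in>Pow (pairs n). m F * of_bool (separated n t a v x F))
      \<le> (case y of (v, x) \<Rightarrow> 2 * (r ^ (t * (n - (2 * t + a))) / w ^ (a + t)) + q ^ (a * a))"
      using separated_bound[of n m K w r q "fst y" "snd y" t a] assms y by (auto simp: case_prod_unfold)
  qed
  also have "\<dots> = real n ^ 2 * (2 * (r ^ (t * (n - (2 * t + a))) / w ^ (a + t)) + q ^ (a * a))"
    by (simp add: power2_eq_square)
  finally show ?thesis .
qed

text \<open>The exploration starts from the empty state and may restart. Its active vertices share
  one component, so if all components are small, then few vertices are active at time
  \<open>t\<close>.\<close>

lemma no_large_component_bound:
  assumes tilt: "tilted n m K w r" and w: "0 < w" "w \<le> 1" and r: "0 < r" "r \<le> 1"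
    and m: "\<And>F. 0 \<le> m F" and "sum m (Pow (pairs n)) = 1"
    and t: "t \<le> n" "t * n \<le> K" "1 \<le> n"
  shows "(\<Sum>F\<in>Pow (pairs n). m F * of_bool (\<forall>C\<in>components n F. card C < a))
    \<le> r ^ (t * (n - (t + a))) / w ^ (a + t)"
proof -
  have P: "cyl n (touching n {}) {} = Pow (pairs n)" by (auto simp: cyl_def touching_def)
  have "(\<Sum>F\<in>Pow (pairs n). m F * of_bool (\<forall>C\<in>components n F. card C < a))
     \<le> (\<Sum>F\<in>Pow (pairs n). m F * of_bool (card (snd (explore n F t ({}, {}))) < a))"
  proof (intro sum_mono mult_left_mono m)
    fix F assume F: "F \<in> Pow (pairs n)"
    obtain v where v: "v \<in> {1..n}" "snd (explore n F t ({}, {})) \<subseteq> joined F `` {v}"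
      using explore_active_connected[of F n t] F t by auto
    have "card (snd (explore n F t ({}, {}))) \<le> card (joined F `` {v})"
      using v(2) joined_subset[of F n v] F v(1) by (intro card_mono) (auto intro: finite_subset)
    then show "of_bool (\<forall>C\<in>components n F. card C < a) \<le> (of_bool (card (snd (explore n F t ({}, {}))) < a) :: real)"
      using v(1) by (auto simp: components_eq dest: bspec[of _ _ v] intro: le_less_trans)
  qed
  also have "\<dots> \<le> r ^ (t * (n - (t + a))) / w ^ (a + t)"
    using few_active_bound[OF tilt w r m, of "({}, {})" t a "{}"] assms by (simp add: P valid_def)
  finally show ?thesis .
qed

text \<open>Inside a component with more than \<open>k\<close> vertices, something is still active
  after \<open>k\<close> steps. The equation of \<open>explore_in_component\<close> then forces at
  least \<open>k\<close> discoveries, the start vertex not being counted.\<close>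

lemma large_component_bound:
  assumes tilt: "tilted n m K w r" and w: "1 \<le> w" and r: "1 \<le> r"
    and m: "\<And>F. 0 \<le> m F" and "sum m (Pow (pairs n)) = 1"
    and k: "k \<le> n" "k * n \<le> K"
  shows "(\<Sum>F\<in>Pow (pairs n). m F * of_bool (\<exists>C\<in>components n F. k < card C)) \<le> n * (r ^ (k * n) / w ^ k)"
proof -
  have P: "cyl n (touching n {}) {} = Pow (pairs n)" by (auto simp: cyl_def touching_def)
  have "(\<Sum>F\<in>Pow (pairs n). m F * of_bool (\<exists>C\<in>components n F. k < card C))
     \<le> (\<Sum>F\<in>Pow (pairs n). m F * (\<Sum>v\<in>{1..n}. of_bool (k \<le> found n F k ({}, {v}))))"
  proof (intro sum_mono mult_left_mono m)
    fix F assume F: "F \<in> Pow (pairs n)"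
    show "of_bool (\<exists>C\<in>components n F. k < card C) \<le> (\<Sum>v\<in>{1..n}. of_bool (k \<le> found n F k ({}, {v})) :: real)"
    proof (cases "\<exists>C\<in>components n F. k < card C")
      case True
      then obtain v where v: "v \<in> {1..n}" "k < card (joined F `` {v})" by (auto simp: components_eq)
      have val: "valid n ({}, {v})" using v by (auto simp: valid_def)
      then have fin: "finite (snd (explore n F k ({}, {v})))"
        using valid_finite[OF valid_explore(1)[OF val]] k by auto
      have "snd (explore n F k ({}, {v})) \<noteq> {}"
        "card (snd (explore n F k ({}, {v}))) + k = Suc (found n F k ({}, {v}))"
        using explore_in_component[OF _ val _ v(2) order_refl] F by auto
      moreover from this fin have "0 < card (snd (explore n F k ({}, {v})))" by (simp add: card_gt_0_iff)
      ultimately have "k \<le> found n F k ({}, {v})" by linarith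
      then have "(1 :: real) = (\<Sum>v\<in>{v}. of_bool (k \<le> found n F k ({}, {v})))" by simp
      also have "\<dots> \<le> (\<Sum>v\<in>{1..n}. of_bool (k \<le> found n F k ({}, {v})))"
        using v by (intro sum_mono2) auto
      finally show ?thesis using True by simp
    qed (auto intro!: sum_nonneg)
  qed
  also have "\<dots> = (\<Sum>v\<in>{1..n}. \<Sum>F\<in>Pow (pairs n). m F * of_bool (k \<le> found n F k ({}, {v})))"
    unfolding sum_distrib_left by (rule sum.swap)
  also have "\<dots> \<le> (\<Sum>v\<in>{1..n}. r ^ (k * n) / w ^ k)"
  proof (intro sum_mono)
    fix v assume "v \<in> {1..n}"
    then show "(\<Sum>F\<in>Pow (pairs n). m F * of_bool (k \<le> found n F k ({}, {v}))) \<le> r ^ (k * n) / w ^ k"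
      using many_found_bound[OF tilt w r m, of "({}, {v})" k k "{}"] assms by (simp add: P valid_def)
  qed
  finally show ?thesis by simp
qed

section \<open>The two regimes\<close>

text \<open>The factor is the mean of \<open>w ^ X\<close> for a Bernoulli variable \<open>X\<close>
  with parameter \<open>q\<close>. For \<open>w \<le> 1\<close> it decreases in \<open>q\<close>, so
  a lower bound on the edge probability suffices.\<close>

lemma tilted_lowerI:
  assumes "\<And>Z B e. Z \<subseteq> pairs n \<Longrightarrow> card Z < K \<Longrightarrow> e \<in> pairs n - Z \<Longrightarrow>
      (\<Sum>F | F \<in> cyl n Z B \<and> e \<notin> F. m F) \<le> (1 - q) * sum m (cyl n Z B)"
    and "w \<le> 1"
  shows "tilted n m K w (1 - q * (1 - w))"
  unfolding tilted_def
proof (intro allI impI)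
  fix Z B e assume "Z \<subseteq> pairs n" "card Z < K" "e \<in> pairs n - Z"
  then have "(1 - w) * (\<Sum>F | F \<in> cyl n Z B \<and> e \<notin> F. m F) \<le> (1 - w) * ((1 - q) * sum m (cyl n Z B))"
    using assms by (intro mult_left_mono) auto
  then show "w * (\<Sum>F | F \<in> cyl n Z B \<and> e \<in> F. m F) + (\<Sum>F | F \<in> cyl n Z B \<and> e \<notin> F. m F)
      \<le> (1 - q * (1 - w)) * sum m (cyl n Z B)"
    unfolding sum_cyl_split[of m n Z B e] by (simp add: algebra_simps)
qed

lemma tilted_upperI:
  assumes "\<And>Z B e. Z \<subseteq> pairs n \<Longrightarrow> card Z < K \<Longrightarrow> e \<in> pairs n - Z \<Longrightarrow>
      (\<Sum>F | F \<in> cyl n Z B \<and> e \<in> F. m F) \<le> q * sum m (cyl n Z B)"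
    and "1 \<le> w"
  shows "tilted n m K w (1 + q * (w - 1))"
  unfolding tilted_def
proof (intro allI impI)
  fix Z B e assume "Z \<subseteq> pairs n" "card Z < K" "e \<in> pairs n - Z"
  then have "(w - 1) * (\<Sum>F | F \<in> cyl n Z B \<and> e \<in> F. m F) \<le> (w - 1) * (q * sum m (cyl n Z B))"
    using assms by (intro mult_left_mono) auto
  then show "w * (\<Sum>F | F \<in> cyl n Z B \<and> e \<in> F. m F) + (\<Sum>F | F \<in> cyl n Z B \<and> e \<notin> F. m F)
      \<le> (1 + q * (w - 1)) * sum m (cyl n Z B)"
    unfolding sum_cyl_split[of m n Z B e] by (simp add: algebra_simps)
qed

lemma (in simplex_graph) prob_graph_of_bool:
  "\<P>(X in \<mu>. \<Phi> (threshold_graph n p X)) = (\<Sum>F\<in>Pow (pairs n). m F * of_bool (\<Phi> F))"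
proof -
  have "{F. F \<in> Pow (pairs n) \<and> \<Phi> F} = Pow (pairs n) \<inter> {F. \<Phi> F}" by auto
  then show ?thesis unfolding prob_graph by simp
qed

lemma (in simplex_graph) prob_graph_ge:
  assumes "(\<Sum>F\<in>Pow (pairs n). m F * of_bool (\<not> \<Phi> F)) \<le> b"
  shows "1 - b \<le> \<P>(X in \<mu>. \<Phi> (threshold_graph n p X))"
  using prob_neg[OF graph_event', of \<Phi>] assms by (simp add: prob_graph_of_bool[symmetric])

lemma whpI:
  assumes "b \<longlonglongrightarrow> 0" "\<forall>\<^sub>F n in sequentially. 1 - b n \<le> \<P>(x in \<mu> n. P n x)"
    and "\<forall>\<^sub>F n in sequentially. prob_space (\<mu> n)"
  shows "whp \<mu> P"
  unfolding whp_def
proof (rule tendsto_sandwich[where f = "\<lambda>n. 1 - b n" and h = "\<lambda>_. 1"])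
  show "\<forall>\<^sub>F n in sequentially. \<P>(x in \<mu> n. P n x) \<le> 1"
    using assms(3) by eventually_elim (rule prob_space.prob_le_1)
  show "(\<lambda>n. 1 - b n) \<longlonglongrightarrow> 1" using tendsto_diff[OF tendsto_const[of 1] assms(1)] by simp
qed (use assms(2) in auto)

lemma M_bounded_simplex_graph:
  assumes "M_bounded n M \<alpha>" "2 \<le> n"
  shows "simplex_graph n \<alpha>"
proof
  fix e assume "e \<in> pairs n"
  then have "1 / M \<le> \<alpha> e" "0 < M" using assms by (auto simp: M_bounded_def)
  then show "0 < \<alpha> e" by (meson less_le_trans zero_less_divide_1_iff)
qed (use assms in auto)

lemma real_choose_two:
  assumes "1 \<le> n"
  shows "real (n choose 2) = real n * (real n - 1) / 2"
proof -
  have "even (n * (n - 1))" by (cases n) auto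
  then show ?thesis using assms by (simp add: choose_two real_of_nat_div of_nat_diff)
qed

text \<open>The gap between the two coefficients absorbs the second-order error of
  \<open>exp (- x)\<close> against \<open>1 - x\<close> once \<open>n\<close> is at least
  \<open>8 / \<epsilon>\<close>.\<close>

lemma exp_le_supercritical:
  assumes "0 < \<epsilon>" "\<epsilon> < (1::real)" "8 / \<epsilon> \<le> real n" "0 < n"
  shows "exp (- ((1 + \<epsilon>) * (1 - \<epsilon> / 8) / n)) \<le> 1 - (1 + \<epsilon> / 2) / n"
proof -
  \<comment> \<open>The coefficient \<open>1 + 3 * \<epsilon> / 4\<close> lies between the two: it
    is at most \<open>(1 + \<epsilon>) * (1 - \<epsilon> / 8)\<close> and leaves
    \<open>\<epsilon> / 4\<close> for the quadratic term.\<close>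
  define x where "x = (1 + 3 * \<epsilon> / 4) / n"
  have n8: "8 \<le> \<epsilon> * n" using assms by (simp add: field_simps)
  have x: "0 \<le> x" "x \<le> 1"
  proof -
    show "0 \<le> x" using assms by (simp add: x_def)
    have "\<epsilon> * real n \<le> 1 * real n" using assms by (intro mult_right_mono) auto
    then have "8 \<le> real n" using n8 by linarith
    then show "x \<le> 1" using assms by (simp add: x_def field_simps)
  qed
  have "\<epsilon> * \<epsilon> \<le> \<epsilon> * 1" using assms by (intro mult_left_mono) auto
  moreover have "(1 + \<epsilon>) * (1 - \<epsilon> / 8) = 1 + 7 * \<epsilon> / 8 - \<epsilon> * \<epsilon> / 8" by (simp add: field_simps)
  ultimately have "1 + 3 * \<epsilon> / 4 \<le> (1 + \<epsilon>) * (1 - \<epsilon> / 8)" using assms by linarith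
  then have "exp (- ((1 + \<epsilon>) * (1 - \<epsilon> / 8) / n)) \<le> exp (- x)"
    using assms by (simp add: x_def divide_right_mono)
  also have "\<dots> \<le> 1 / (1 + x + x\<^sup>2 / 2)"
  proof -
    have "1 + x + x\<^sup>2 / 2 \<le> exp x" using exp_lower_Taylor_quadratic[OF x(1)] by simp
    moreover have "0 < 1 + x + x\<^sup>2 / 2" using x by (simp add: add_pos_nonneg)
    ultimately show ?thesis by (simp add: exp_minus field_simps)
  qed
  also have "\<dots> \<le> 1 - x + x\<^sup>2 / 2"
  proof -
    have "(1 - x + x\<^sup>2 / 2) * (1 + x + x\<^sup>2 / 2) = 1 + (x\<^sup>2 / 2)\<^sup>2"
      by (simp add: algebra_simps power2_eq_square)
    then have "1 \<le> (1 - x + x\<^sup>2 / 2) * (1 + x + x\<^sup>2 / 2)" by simp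
    moreover have "0 < 1 + x + x\<^sup>2 / 2" using x by (simp add: add_pos_nonneg)
    ultimately show ?thesis by (simp add: pos_divide_le_eq)
  qed
  also have "\<dots> \<le> 1 - (1 + \<epsilon> / 2) / n"
  proof -
    have "x * n \<le> 2" using assms by (simp add: x_def)
    then have "x * (x * n) \<le> x * 2" using x by (intro mult_left_mono) auto
    then have "x * (x * n) * n \<le> x * 2 * n" by (intro mult_right_mono) auto
    then have "x\<^sup>2 * n\<^sup>2 \<le> x * n * 2" by (simp add: power2_eq_square mult_ac)
    then have "x\<^sup>2 / 2 * n\<^sup>2 \<le> \<epsilon> * n / 4" using \<open>x * n \<le> 2\<close> n8 by linarith
    then have "x\<^sup>2 / 2 \<le> \<epsilon> / 4 / n" using assms by (simp add: field_simps power2_eq_square)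
    moreover have "x - \<epsilon> / 4 / n = (1 + \<epsilon> / 2) / n"
      unfolding x_def diff_divide_distrib[symmetric] by simp
    ultimately show ?thesis by linarith
  qed
  finally show ?thesis .
qed

text \<open>The lower bound on the weights cancels the \<open>M\<close> in \<open>p\<close>, giving
  \<open>\<alpha> e * p \<ge> (1 + \<epsilon>) / n\<close>. As at most a fraction
  \<open>\<epsilon> / 8\<close> of the pairs is exposed, the exponent in
  \<open>sum_absent_le\<close> loses only the factor \<open>1 - \<epsilon> / 8\<close>.\<close>

lemma supercritical_tilted:
  assumes \<epsilon>: "0 < \<epsilon>" "\<epsilon> < 1" and M: "M_bounded n M \<alpha>" and p: "(1 + \<epsilon>) * M / n \<le> p"
    and n: "2 \<le> n" "8 / \<epsilon> \<le> n" and w: "w \<le> 1" and K: "K \<le> \<epsilon> / 8 * (n choose 2)"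
  shows "tilted n (graph_prob n \<alpha> p) K w (1 - (1 + \<epsilon> / 2) / n * (1 - w))"
proof (rule tilted_lowerI[OF _ w])
  interpret simplex_graph n \<alpha> p using M_bounded_simplex_graph[OF M n(1)] .
  fix Z B e assume Z: "Z \<subseteq> pairs n" "card Z < K" "e \<in> pairs n - Z"
  have M0: "0 < M" "1 / M \<le> \<alpha> e" using M Z by (auto simp: M_bounded_def)
  have p0: "0 \<le> p" using order_trans[OF _ p] \<epsilon> M0 by simp
  have "(1 + \<epsilon>) / n = 1 / M * ((1 + \<epsilon>) * M / n)" using M0 by simp
  also have "\<dots> \<le> \<alpha> e * p" using M0 p p0 \<epsilon> by (intro mult_mono) (auto intro: order_trans[of 0 "1 / M"])
  finally have ap: "(1 + \<epsilon>) / n \<le> \<alpha> e * p" .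
  have cZ: "card Z \<le> n choose 2" using card_mono[OF finite_pairs Z(1)] by (simp add: card_pairs)
  have "real (card Z) \<le> \<epsilon> / 8 * N" using Z K by linarith
  then have "1 - \<epsilon> / 8 \<le> real ((n choose 2) - card Z) / N"
    using N_pos cZ by (simp add: of_nat_diff field_simps)
  then have "(1 + \<epsilon>) / n * (1 - \<epsilon> / 8) \<le> \<alpha> e * p * (real ((n choose 2) - card Z) / N)"
  proof (rule mult_mono[OF ap])
    show "0 \<le> \<alpha> e * p" using ap \<epsilon> by (intro order_trans[OF _ ap]) auto
  qed (use \<epsilon> in auto)
  then have "exp (- (\<alpha> e * p) / N) ^ ((n choose 2) - card Z) \<le> exp (- ((1 + \<epsilon>) * (1 - \<epsilon> / 8) / n))"
    by (simp add: exp_of_nat_mult[symmetric] mult_ac)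
  also have "\<dots> \<le> 1 - (1 + \<epsilon> / 2) / n" using \<epsilon> n by (intro exp_le_supercritical) auto
  finally have le: "exp (- (\<alpha> e * p) / N) ^ ((n choose 2) - card Z) \<le> 1 - (1 + \<epsilon> / 2) / n" .
  have "(\<Sum>F | F \<in> cyl n Z B \<and> e \<notin> F. m F)
     \<le> exp (- (\<alpha> e * p) / N) ^ ((n choose 2) - card Z) * sum m (cyl n Z B)"
    using Z p0 by (intro sum_absent_le)
  also have "\<dots> \<le> (1 - (1 + \<epsilon> / 2) / n) * sum m (cyl n Z B)"
    by (intro mult_right_mono le sum_nonneg graph_prob_nonneg)
  finally show "(\<Sum>F | F \<in> cyl n Z B \<and> e \<notin> F. m F) \<le> (1 - (1 + \<epsilon> / 2) / n) * sum m (cyl n Z B)" .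
qed

text \<open>The upper bound on the weights gives
  \<open>\<alpha> i * p \<le> (1 - \<epsilon>) / n\<close>, so exposing \<open>k * n\<close> pairs
  uses up at most \<open>k\<close> of the budget, a fraction \<open>\<epsilon> / 2\<close> of
  it.\<close>

lemma subcritical_tilted:
  assumes \<epsilon>: "0 < \<epsilon>" "\<epsilon> < 1" and M: "M_bounded n M \<alpha>" and p: "p \<le> (1 - \<epsilon>) / (M * n)"
    and n: "2 \<le> n" and w: "1 \<le> w" and k: "k \<le> \<epsilon> / 2 * (n choose 2)"
  shows "tilted n (graph_prob n \<alpha> p) (k * n) w (1 + (1 - \<epsilon> / 2) / n * (w - 1))"
proof (rule tilted_upperI[OF _ w])
  interpret simplex_graph n \<alpha> p using M_bounded_simplex_graph[OF M n] .
  fix Z B e assume Z: "Z \<subseteq> pairs n" "card Z < k * n" "e \<in> pairs n - Z"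
  have ap: "\<alpha> i * p \<le> (1 - \<epsilon>) / n" if "i \<in> pairs n" for i
  proof -
    have M0: "0 < M" "\<alpha> i \<le> M" using M that by (auto simp: M_bounded_def)
    have "\<alpha> i * p \<le> \<alpha> i * ((1 - \<epsilon>) / (M * n))" using p pos[OF that] by (intro mult_left_mono) auto
    also have "\<dots> \<le> M * ((1 - \<epsilon>) / (M * n))" using M0 \<epsilon> by (intro mult_right_mono) auto
    finally show ?thesis using M0 by simp
  qed
  have fZ: "finite Z" using Z by (auto intro: finite_subset)
  \<comment> \<open>Stated for up to \<open>k * n\<close> pairs inclusive, so that it covers
    \<open>insert e Z\<close> as well as \<open>Z\<close>.\<close>
  have S: "(\<Sum>i\<in>Y. \<alpha> i * p) \<le> \<epsilon> / 2 * N" if Y: "Y \<subseteq> pairs n" "card Y \<le> k * n" for Y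
  proof -
    have "(\<Sum>i\<in>Y. \<alpha> i * p) \<le> (\<Sum>i\<in>Y. (1 - \<epsilon>) / n)" using ap Y by (intro sum_mono) auto
    also have "\<dots> = card Y * ((1 - \<epsilon>) / n)" by simp
    also have "\<dots> \<le> real (k * n) * ((1 - \<epsilon>) / n)"
      using Y \<epsilon> by (intro mult_right_mono) (simp_all only: of_nat_le_iff, auto)
    also have "\<dots> = k * (1 - \<epsilon>)" using n by simp
    also have "\<dots> \<le> real k * 1" using \<epsilon> by (intro mult_left_mono) auto
    finally show ?thesis using k by simp
  qed
  have "\<epsilon> / 2 * N < N" using N_pos \<epsilon> by simp
  moreover have "(\<Sum>i\<in>insert e Z. \<alpha> i * p) \<le> \<epsilon> / 2 * N" using Z fZ by (intro S) auto
  ultimately have lt: "(\<Sum>i\<in>insert e Z. \<alpha> i * p) < N" by linarith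
  have D: "N * (1 - \<epsilon> / 2) \<le> N - (\<Sum>i\<in>Z. \<alpha> i * p)"
    using S[of Z] Z by (simp add: algebra_simps)
  moreover have "0 < N * (1 - \<epsilon> / 2)" using N_pos \<epsilon> by simp
  ultimately have Dpos: "0 < N - (\<Sum>i\<in>Z. \<alpha> i * p)" by linarith
  have "N * (\<alpha> e * p) \<le> N * ((1 - \<epsilon>) / n)" using ap Z N_pos by (intro mult_left_mono) auto
  \<comment> \<open>Of the two factors \<open>1 - \<epsilon> / 2\<close>, one pays for the reduced
    budget and the other remains in the edge probability.\<close>
  also have "\<dots> \<le> N * ((1 - \<epsilon> / 2)\<^sup>2 / n)"
    using N_pos by (intro mult_left_mono divide_right_mono) (auto simp: power2_eq_square algebra_simps)
  also have "\<dots> = (1 - \<epsilon> / 2) / n * (N * (1 - \<epsilon> / 2))" by (simp add: power2_eq_square)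
  also have "\<dots> \<le> (1 - \<epsilon> / 2) / n * (N - (\<Sum>i\<in>Z. \<alpha> i * p))"
    using D \<epsilon> by (intro mult_left_mono) auto
  finally have "N * (\<alpha> e * p) / (N - (\<Sum>i\<in>Z. \<alpha> i * p)) \<le> (1 - \<epsilon> / 2) / n"
    using Dpos by (simp add: pos_divide_le_eq)
  then show "(\<Sum>F | F \<in> cyl n Z B \<and> e \<in> F. m F) \<le> (1 - \<epsilon> / 2) / n * sum m (cyl n Z B)"
    using Z lt \<epsilon> n by (intro sum_present_le) (auto simp: divide_le_eq)
qed


text \<open>The queries contribute an exponent of at most
  \<open>- (1 + \<epsilon> / 4) * (1 - w) * t\<close>, the discoveries one of at most
  \<open>(1 + \<epsilon> / 8) * (1 - w) / w * t\<close>. The choice of \<open>w\<close> makes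
  \<open>(1 + \<epsilon> / 8) / w\<close> equal to \<open>1 + 3 * \<epsilon> / 16\<close>, which
  leaves a margin of \<open>\<epsilon> / 16\<close>.\<close>

lemma supercritical_decay:
  assumes \<epsilon>: "0 < \<epsilon>" "\<epsilon> < (1::real)" and n: "0 < n" and a: "a \<le> \<epsilon> * t / 8"
    and ta: "2 * t + a \<le> \<epsilon> * n / 8"
  defines "w \<equiv> (1 + \<epsilon> / 8) / (1 + 3 * \<epsilon> / 16)"
  defines "r \<equiv> 1 - (1 + \<epsilon> / 2) / n * (1 - w)"
  assumes r: "0 < r"
  shows "r ^ (t * (n - (2 * t + a))) / w ^ (a + t) \<le> exp (- (\<epsilon> / 16 * (1 - w)) * t)"
proof -
  have w: "0 < w" "w < 1" using \<epsilon> by (auto simp: w_def)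
  have "ln r \<le> r - 1" using r by (rule ln_le_minus_one)
  then have lr: "ln r \<le> - ((1 + \<epsilon> / 2) / n * (1 - w))" by (simp add: r_def)
  have tn: "2 * t + a \<le> n"
  proof -
    have "\<epsilon> * n \<le> 1 * real n" using \<epsilon> by (intro mult_right_mono) auto
    then have "real (2 * t + a) \<le> real n" using ta by simp
    then show ?thesis by (simp only: of_nat_le_iff)
  qed
  have "real n * (1 - \<epsilon> / 8) \<le> real (n - (2 * t + a))"
    using ta tn by (simp add: of_nat_diff algebra_simps)
  then have q: "t * (real n * (1 - \<epsilon> / 8)) \<le> real (t * (n - (2 * t + a)))"
    unfolding of_nat_mult by (rule mult_left_mono) simp
  have "r ^ (t * (n - (2 * t + a))) = exp (real (t * (n - (2 * t + a))) * ln r)"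
    using r by (metis exp_ln exp_of_nat_mult)
  also have "\<dots> \<le> exp (- (t * (1 + \<epsilon> / 4) * (1 - w)))"
  proof -
    have "real (t * (n - (2 * t + a))) * ln r
        \<le> real (t * (n - (2 * t + a))) * (- ((1 + \<epsilon> / 2) / n * (1 - w)))"
      using lr by (rule mult_left_mono) simp
    also have "\<dots> \<le> t * (real n * (1 - \<epsilon> / 8)) * (- ((1 + \<epsilon> / 2) / n * (1 - w)))"
      using q w \<epsilon> by (intro mult_right_mono_neg) auto
    also have "\<dots> = - (t * ((1 - \<epsilon> / 8) * (1 + \<epsilon> / 2)) * (1 - w))"
      using n by (simp add: field_simps)
    also have "\<dots> \<le> - (t * (1 + \<epsilon> / 4) * (1 - w))"
    proof -
      have "\<epsilon> * \<epsilon> \<le> \<epsilon> * 1" using \<epsilon> by (intro mult_left_mono) auto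
      moreover have "(1 - \<epsilon> / 8) * (1 + \<epsilon> / 2) = 1 + 3 * \<epsilon> / 8 - \<epsilon> * \<epsilon> / 16" by (simp add: field_simps)
      ultimately have "1 + \<epsilon> / 4 \<le> (1 - \<epsilon> / 8) * (1 + \<epsilon> / 2)" using \<epsilon> by linarith
      then show ?thesis using w by (simp add: mult_left_mono mult_right_mono)
    qed
    finally show ?thesis by simp
  qed
  finally have 1: "r ^ (t * (n - (2 * t + a))) \<le> exp (- (t * (1 + \<epsilon> / 4) * (1 - w)))" .
  have "ln (1 / w) \<le> 1 / w - 1" using w by (intro ln_le_minus_one) auto
  then have lw: "- ln w \<le> (1 - w) / w" using w by (simp add: ln_div diff_divide_distrib)
  have lw0: "0 \<le> - ln w" using w by simp
  have "1 / w ^ (a + t) = exp (real (a + t) * (- ln w))"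
  proof -
    have "exp (real (a + t) * (- ln w)) = inverse (exp (real (a + t) * ln w))" by (simp add: exp_minus)
    also have "exp (real (a + t) * ln w) = w ^ (a + t)" using w by (metis exp_ln exp_of_nat_mult)
    finally show ?thesis by (simp add: divide_inverse)
  qed
  also have "\<dots> \<le> exp ((t * (1 + \<epsilon> / 8)) * ((1 - w) / w))"
    using a lw lw0 by (subst exp_le_cancel_iff, intro mult_mono) (auto simp: algebra_simps)
  also have "(t * (1 + \<epsilon> / 8)) * ((1 - w) / w) = t * (1 + 3 * \<epsilon> / 16) * (1 - w)"
    using \<epsilon> by (simp add: w_def)
  finally have 2: "1 / w ^ (a + t) \<le> exp (t * (1 + 3 * \<epsilon> / 16) * (1 - w))" .
  have "r ^ (t * (n - (2 * t + a))) / w ^ (a + t) = r ^ (t * (n - (2 * t + a))) * (1 / w ^ (a + t))" by simp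
  also have "\<dots> \<le> exp (- (t * (1 + \<epsilon> / 4) * (1 - w))) * exp (t * (1 + 3 * \<epsilon> / 16) * (1 - w))"
    using 1 2 w by (intro mult_mono) auto
  also have "\<dots> = exp (- (\<epsilon> / 16 * (1 - w)) * t)"
  proof -
    have "- (t * (1 + \<epsilon> / 4) * (1 - w)) + t * (1 + 3 * \<epsilon> / 16) * (1 - w) = - (\<epsilon> / 16 * (1 - w)) * t"
      by (simp add: field_simps)
    then show ?thesis by (simp only: exp_add[symmetric])
  qed
  finally show ?thesis .
qed

section \<open>Conclusions with high probability\<close>

lemma max_component_size_le_iff:
  assumes "1 \<le> n"
  shows "max_component_size n F \<le> k \<longleftrightarrow> (\<forall>C\<in>components n F. card C \<le> k)"
proof -
  have "finite (card ` components n F)" "card ` components n F \<noteq> {}"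
    using assms by (auto simp: components_eq)
  then show ?thesis by (simp add: max_component_size_def)
qed

text \<open>\<open>\<delta>\<close> is the Chernoff rate for a Poisson variable of mean
  \<open>1 - \<epsilon> / 2\<close> per step to keep up with one discovery per step.\<close>

lemma subcritical_whp:
  assumes \<epsilon>: "0 < \<epsilon>" "\<epsilon> < (1::real)"
  defines "\<delta> \<equiv> - (\<epsilon> / 2 + ln (1 - \<epsilon> / 2))"
  assumes M: "\<forall>n. M_bounded n (M n) (\<alpha> n)" and p: "\<forall>n\<ge>1. p n \<le> (1 - \<epsilon>) / (M n * real n)"
  shows "whp (\<lambda>n. unif_simplex n (\<alpha> n))
    (\<lambda>n X. real (max_component_size n (threshold_graph n (p n) X)) \<le> (2 / \<delta> + 1) * ln (real n))"
proof (rule whpI)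
  define x where "x = \<epsilon> / 2"
  have x: "0 < x" "x < 1" using \<epsilon> by (auto simp: x_def)
  have \<delta>: "0 < \<delta>"
  proof -
    have "ln (1 - x) < - x"
      using exp_minus_greater[of x] x by (metis diff_gt_0_iff_gt ln_exp ln_less_cancel_iff exp_gt_zero less_irrefl)
    then show ?thesis by (simp add: \<delta>_def x_def)
  qed
  define C where "C = 2 / \<delta> + 1"
  have C: "0 < C" using \<delta> by (simp add: C_def add_pos_pos)
  have ev1: "\<forall>\<^sub>F n in sequentially. C * ln (real n) \<le> real n" using C by real_asymp
  have ev2: "\<forall>\<^sub>F n in sequentially. C * ln (real n) \<le> \<epsilon> / 2 * (real n * (real n - 1) / 2)"
    using C \<epsilon> by real_asymp
  show "(\<lambda>n. 1 / real n) \<longlonglongrightarrow> 0" by real_asymp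
  show "\<forall>\<^sub>F n in sequentially. prob_space (unif_simplex n (\<alpha> n))"
    using eventually_ge_at_top[of 2]
  proof eventually_elim
    case (elim n)
    then interpret simplex_graph n "\<alpha> n" "p n" using M M_bounded_simplex_graph by blast
    show ?case by (rule prob_space_axioms)
  qed
  show "\<forall>\<^sub>F n in sequentially. 1 - 1 / real n \<le> \<P>(X in unif_simplex n (\<alpha> n).
      real (max_component_size n (threshold_graph n (p n) X)) \<le> (2 / \<delta> + 1) * ln (real n))"
    using ev1 ev2 eventually_ge_at_top[of 3]
  proof eventually_elim
    case (elim n)
    have n: "2 \<le> n" "1 \<le> n" "0 < real n" using elim by auto
    interpret simplex_graph n "\<alpha> n" "p n" using M M_bounded_simplex_graph n by blast
    \<comment> \<open>Chosen so that \<open>exp (- \<delta> * k)\<close> is at most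
      \<open>1 / n ^ 2\<close>, leaving \<open>1 / n\<close> after the union bound over starting
      vertices.\<close>
    define k where "k = nat \<lceil>2 * ln (real n) / \<delta>\<rceil>"
    \<comment> \<open>The tilt that minimises \<open>exp ((1 - x) * (w - 1)) / w\<close>, the bound
      on the factor per step.\<close>
    define w where "w = 1 / (1 - x)"
    define r where "r = 1 + (1 - \<epsilon> / 2) / n * (w - 1)"
    have w: "1 \<le> w" using x by (simp add: w_def)
    have "(1 - x) * (w - 1) = x" using x by (simp add: w_def field_simps)
    then have r: "r = 1 + x / n" by (simp add: r_def x_def[symmetric])
    \<comment> \<open>This is why \<open>n\<close> is at least 3: the rounding of \<open>k\<close>
      is absorbed by the summand 1 in \<open>C\<close>.\<close>
    have ln1: "1 \<le> ln (real n)"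
    proof -
      have "exp 1 \<le> real n" using exp_le elim by linarith
      then show ?thesis using n by (simp add: ln_ge_iff)
    qed
    have k2: "2 * ln (real n) / \<delta> \<le> k" by (simp add: k_def) linarith
    have "real k \<le> 2 * ln (real n) / \<delta> + 1" using ln1 \<delta> by (simp add: k_def)
    also have "\<dots> \<le> C * ln (real n)" using ln1 by (simp add: C_def algebra_simps)
    finally have kC: "real k \<le> C * ln (real n)" .
    have "real k \<le> real n" using kC elim by linarith
    then have kn: "k \<le> n" by simp
    have "real (n choose 2) = real n * (real n - 1) / 2" using n by (intro real_choose_two)
    then have kN: "real k \<le> \<epsilon> / 2 * (n choose 2)" using order_trans[OF kC elim(2)] by (simp only:)
    have tilt: "tilted n m (k * n) w r"
      unfolding r_def using M p n kN \<epsilon> w by (intro subcritical_tilted[where M = "M n"]) auto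
    have "(\<Sum>F\<in>Pow (pairs n). m F * of_bool (\<exists>C\<in>components n F. k < card C)) \<le> n * (r ^ (k * n) / w ^ k)"
      using x n kn sum_graph_prob graph_prob_nonneg
      by (intro large_component_bound[OF tilt w]) (auto simp: r)
    also have "\<dots> \<le> n * exp (- 2 * ln (real n))"
    proof (intro mult_left_mono)
      have "r ^ (k * n) \<le> exp (x / n) ^ (k * n)"
        using exp_ge_add_one_self[of "x / n"] x n by (intro power_mono) (auto simp: r)
      also have "\<dots> = exp (x * k)" using n by (simp add: exp_of_nat_mult[symmetric])
      finally have "r ^ (k * n) \<le> exp (x * k)" .
      then have "r ^ (k * n) / w ^ k \<le> exp (x * k) / w ^ k" using w by (intro divide_right_mono) auto
      also have "\<dots> = exp (x * k) * (1 - x) ^ k" using x by (simp add: w_def power_one_over)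
      also have "(1 - x) ^ k = exp (k * ln (1 - x))" using x by (metis exp_ln exp_of_nat_mult diff_gt_0_iff_gt)
      also have "exp (x * k) * exp (k * ln (1 - x)) = exp (- (\<delta> * k))"
        by (simp add: exp_add[symmetric] \<delta>_def x_def algebra_simps)
      also have "\<dots> \<le> exp (- 2 * ln (real n))" using k2 \<delta> by (simp add: field_simps)
      finally show "r ^ (k * n) / w ^ k \<le> exp (- 2 * ln (real n))" .
    qed simp
    also have "\<dots> = 1 / real n"
    proof -
      have "exp (- 2 * ln (real n)) = inverse (exp (ln (real n)) * exp (ln (real n)))"
        by (simp add: exp_minus exp_add[symmetric])
      then show ?thesis using n by (simp add: field_simps)
    qed
    finally have "(\<Sum>F\<in>Pow (pairs n). m F * of_bool (\<not> (\<forall>C\<in>components n F. card C \<le> k))) \<le> 1 / real n"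
      by (simp only: not_le Ball_def Bex_def not_all not_imp)
    then have "1 - 1 / real n \<le> \<P>(X in \<mu>. \<forall>C\<in>components n (threshold_graph n (p n) X). card C \<le> k)"
      by (rule prob_graph_ge)
    also have "\<dots> \<le> \<P>(X in \<mu>. real (max_component_size n (threshold_graph n (p n) X)) \<le> C * ln (real n))"
    proof (rule finite_measure_mono)
      show "{X \<in> space \<mu>. \<forall>C\<in>components n (threshold_graph n (p n) X). card C \<le> k}
        \<subseteq> {X \<in> space \<mu>. real (max_component_size n (threshold_graph n (p n) X)) \<le> C * ln (real n)}"
        using kC n(2) by (auto simp: max_component_size_le_iff[symmetric] intro: order_trans[OF _ kC])
    qed (rule graph_event'[of "\<lambda>F. real (max_component_size n F) \<le> C * ln (real n)"])
    finally show ?case by (simp add: C_def)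
  qed
qed

text \<open>Two exploration lengths are used: \<open>\<delta>' * n\<close>, independent of
  \<open>c\<close>, for the existence of a large component, and the shorter
  \<open>\<delta> * n\<close> for uniqueness above the threshold \<open>c * n\<close>.\<close>

lemma supercritical_whp:
  assumes \<epsilon>: "0 < \<epsilon>" "\<epsilon> < (1::real)" and c: "0 < c" "c \<le> \<epsilon>\<^sup>2 / 2048"
  assumes M: "\<forall>n. M_bounded n (M n) (\<alpha> n)" and p: "\<forall>n\<ge>1. (1 + \<epsilon>) * M n / real n \<le> p n"
  shows "whp (\<lambda>n. unif_simplex n (\<alpha> n))
    (\<lambda>n X. \<exists>K. unique_giant c n (threshold_graph n (p n) X) K \<and> \<epsilon>\<^sup>2 / 2048 * real n \<le> real (card K))"
proof (rule whpI)
  define w where "w = (1 + \<epsilon> / 8) / (1 + 3 * \<epsilon> / 16)"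
  have w: "0 < w" "w < 1" using \<epsilon> by (auto simp: w_def)
  define \<gamma> where "\<gamma> = \<epsilon> / 16 * (1 - w)"
  have \<gamma>: "0 < \<gamma>" using \<epsilon> w by (simp add: \<gamma>_def)
  define t where "t = (\<lambda>(\<delta>::real) n. nat \<lfloor>\<delta> * real n\<rfloor>)"
  define a where "a = (\<lambda>\<delta> n. nat \<lfloor>\<epsilon> * real (t \<delta> n) / 8\<rfloor>)"
  \<comment> \<open>About \<open>\<epsilon> * \<delta>' * n / 8\<close> vertices are then active,
    which is \<open>\<epsilon>\<^sup>2 / 512 * n\<close>; crude roundings reduce this to
    \<open>\<epsilon>\<^sup>2 / 2048 * n\<close>.\<close>
  define \<delta>' where "\<delta>' = \<epsilon> / 64"
  \<comment> \<open>With half of \<open>c\<close>, every component of at least \<open>c * n\<close>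
    vertices has more than \<open>t \<delta> n\<close> of them.\<close>
  define \<delta> where "\<delta> = c / 2"
  have "\<epsilon>\<^sup>2 \<le> \<epsilon>" using \<epsilon> by (simp add: power2_eq_square mult_left_le)
  then have \<delta>: "0 < \<delta>" "\<delta> \<le> \<epsilon> / 128" and \<delta>': "0 < \<delta>'" "\<delta>' \<le> \<epsilon> / 64"
    using c \<epsilon> by (auto simp: \<delta>_def \<delta>'_def)
  \<comment> \<open>The first term bounds the failure of existence, the second that of uniqueness,
    where \<open>(\<epsilon> * \<delta> / 32 * n)\<^sup>2\<close> pairs of probability at least
    \<open>1 / n\<close> would all have to be non-edges.\<close>
  define b where "b = (\<lambda>n. exp (- \<gamma> * (\<delta>' * real n / 2))
    + real n ^ 2 * (2 * exp (- \<gamma> * (\<delta> * real n / 2)) + exp (- ((\<epsilon> * \<delta> / 32)\<^sup>2 * real n))))"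
  have t_le: "real (t d n) \<le> d * n" if "0 < d" for d n using that by (simp add: t_def)
  have a_le: "real (a d n) \<le> \<epsilon> * real (t d n) / 8" for d n
  proof -
    have "0 \<le> \<epsilon> * real (t d n) / 8" using \<epsilon> by simp
    then show ?thesis unfolding a_def by linarith
  qed
  have t_ge: "\<forall>\<^sub>F n in sequentially. d * real n / 2 \<le> real (t d n)" if d: "0 < d" for d
  proof -
    have "\<forall>\<^sub>F n in sequentially. d * real n / 2 \<le> d * real n - 1" using d by real_asymp
    then show ?thesis
    proof eventually_elim
      case (elim n)
      moreover have "d * real n - 1 \<le> real (t d n)" unfolding t_def by linarith
      ultimately show ?case by linarith
    qed
  qed
  have a_ge: "\<forall>\<^sub>F n in sequentially. \<epsilon> * d / 16 * n - 1 \<le> real (a d n)" if d: "0 < d" for d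
    using t_ge[OF d]
  proof eventually_elim
    case (elim n)
    have "\<epsilon> * (d * real n / 2) \<le> \<epsilon> * real (t d n)" using elim \<epsilon> by (intro mult_left_mono) auto
    moreover have "\<epsilon> * real (t d n) / 8 - 1 \<le> real (a d n)" unfolding a_def by linarith
    ultimately show ?case by (simp add: algebra_simps)
  qed
  have \<epsilon>\<delta>: "0 < \<epsilon> * \<delta>" using \<epsilon> \<delta> by simp
  have ev1: "\<forall>\<^sub>F n in sequentially. \<epsilon> * \<delta> / 32 * n \<le> real (a \<delta> n)"
  proof -
    have "\<forall>\<^sub>F n in sequentially. \<epsilon> * \<delta> / 32 * real n \<le> \<epsilon> * \<delta> / 16 * real n - 1" using \<epsilon> \<delta> by real_asymp
    then show ?thesis using a_ge[OF \<delta>(1)] by eventually_elim linarith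
  qed
  have ev2: "\<forall>\<^sub>F n in sequentially. \<epsilon>\<^sup>2 / 2048 * n \<le> real (a \<delta>' n)"
  proof -
    have "\<forall>\<^sub>F n in sequentially. \<epsilon>\<^sup>2 / 2048 * real n \<le> \<epsilon> * \<delta>' / 16 * real n - 1"
    proof -
      have "0 < \<epsilon>\<^sup>2" using \<epsilon> by simp
      then have "\<forall>\<^sub>F n in sequentially. \<epsilon>\<^sup>2 / 2048 * real n \<le> \<epsilon>\<^sup>2 / 1024 * real n - 1" by real_asymp
      then show ?thesis by (simp add: \<delta>'_def power2_eq_square)
    qed
    then show ?thesis using a_ge[OF \<delta>'(1)] by eventually_elim linarith
  qed
  \<comment> \<open>The left side bounds the exposure
    \<open>2 * t * n + a * a \<le> 3 * t * n\<close> of the uniqueness argument; the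
    \<open>- 1\<close> allows for the floor in \<open>K\<close>.\<close>
  have ev3: "\<forall>\<^sub>F n in sequentially. 3 * (\<epsilon> / 128 * real n) * real n \<le> \<epsilon> / 8 * (real n * (real n - 1) / 2) - 1"
    using \<epsilon> by real_asymp
  have ev4: "\<forall>\<^sub>F n in sequentially. 8 / \<epsilon> \<le> real n"
    by (rule eventually_sequentiallyI[of "nat \<lceil>8 / \<epsilon>\<rceil>"]) linarith
  show "b \<longlonglongrightarrow> 0"
  proof -
    have *: "(\<lambda>n. exp (- (A * real n)) + real n ^ 2 * (2 * exp (- (B * real n)) + exp (- (C * real n)))) \<longlonglongrightarrow> 0"
      if "0 < A" "0 < B" "0 < C" for A B C :: real
    proof -
      have 1: "(\<lambda>n. exp (- (A * real n))) \<longlonglongrightarrow> 0" using that by real_asymp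
      have 2: "(\<lambda>n. real n ^ 2 * exp (- (B' * real n))) \<longlonglongrightarrow> 0" if "0 < B'" for B' :: real
        using that by real_asymp
      from tendsto_add[OF 1 tendsto_add[OF tendsto_mult[OF tendsto_const[of 2] 2[OF that(2)]] 2[OF that(3)]]]
      show ?thesis by (simp add: algebra_simps)
    qed
    have "0 < \<gamma> * \<delta>' / 2" "0 < \<gamma> * \<delta> / 2" "0 < (\<epsilon> * \<delta> / 32)\<^sup>2" using \<gamma> \<delta> \<delta>' \<epsilon>\<delta> by auto
    from *[OF this] show ?thesis by (simp add: b_def mult_ac)
  qed
  show "\<forall>\<^sub>F n in sequentially. prob_space (unif_simplex n (\<alpha> n))"
    using eventually_ge_at_top[of 2]
  proof eventually_elim
    case (elim n)
    then interpret simplex_graph n "\<alpha> n" "p n" using M M_bounded_simplex_graph by blast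
    show ?case by (rule prob_space_axioms)
  qed
  show "\<forall>\<^sub>F n in sequentially. 1 - b n \<le> \<P>(X in unif_simplex n (\<alpha> n).
      \<exists>K. unique_giant c n (threshold_graph n (p n) X) K \<and> \<epsilon>\<^sup>2 / 2048 * real n \<le> real (card K))"
    using t_ge[OF \<delta>(1)] t_ge[OF \<delta>'(1)] ev1 ev2 ev3 ev4 eventually_ge_at_top[of 2]
  proof eventually_elim
    case (elim n)
    have n: "2 \<le> n" "1 \<le> n" "0 < real n" "0 < n" using elim by auto
    interpret simplex_graph n "\<alpha> n" "p n" using M M_bounded_simplex_graph n by blast
    define q where "q = (1 + \<epsilon> / 2) / n"
    define r where "r = 1 - q * (1 - w)"
    define K where "K = nat \<lfloor>\<epsilon> / 8 * N\<rfloor>"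
    have q: "0 < q" "q < 1" using \<epsilon> n by (auto simp: q_def)
    have qw: "0 < q * (1 - w)" "q * (1 - w) < 1 * 1"
      using q w by (simp, intro mult_strict_mono) auto
    then have r: "0 < r" "r \<le> 1" by (auto simp: r_def)
    have N: "N = real n * (real n - 1) / 2" using n by (intro real_choose_two)
    have "0 \<le> \<epsilon> / 8 * N" using \<epsilon> by simp
    then have KN: "real K \<le> \<epsilon> / 8 * N" unfolding K_def by linarith
    have "\<epsilon> / 8 * N - 1 \<le> real K" by (simp add: K_def) linarith
    then have K3: "3 * (\<epsilon> / 128 * real n) * real n \<le> real K" using elim N by simp
    have tilt: "tilted n m K w' (1 - q * (1 - w'))" if "w' \<le> 1" for w'
      unfolding q_def using M p n elim(6) \<epsilon> KN that
      by (intro supercritical_tilted[where M = "M n"]) auto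
    have tilt0: "tilted n m K 0 (1 - q)" using tilt[of 0] by simp
    have a_t: "a d n \<le> t d n" for d
    proof -
      have "\<epsilon> * real (t d n) \<le> 1 * real (t d n)" using \<epsilon> by (intro mult_right_mono) auto
      then have "real (a d n) \<le> real (t d n)" using a_le[of d n] by simp
      then show ?thesis by simp
    qed
    have t64: "real (t d n) \<le> \<epsilon> / 64 * n" if "0 < d" "d \<le> \<epsilon> / 64" for d
      using t_le[OF that(1), of n] mult_right_mono[OF that(2), of "real n"] by simp
    have decay: "r ^ (t d n * (n - (2 * t d n + a d n))) / w ^ (a d n + t d n) \<le> exp (- \<gamma> * (d * real n / 2))"
      if d: "0 < d" "d \<le> \<epsilon> / 64" "d * real n / 2 \<le> real (t d n)" for d
    proof -
      have "real (2 * t d n + a d n) \<le> \<epsilon> * real n / 8"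
        using t64[OF d(1,2)] a_t[of d] by simp
      then have "r ^ (t d n * (n - (2 * t d n + a d n))) / w ^ (a d n + t d n) \<le> exp (- (\<epsilon> / 16 * (1 - w)) * t d n)"
        using r(1) unfolding r_def q_def w_def by (rule supercritical_decay[OF \<epsilon> n(4) a_le])
      also have "\<dots> \<le> exp (- \<gamma> * (d * real n / 2))"
        using mult_left_mono[OF d(3) less_imp_le[OF \<gamma>]]
        unfolding \<gamma>_def[symmetric] exp_le_cancel_iff mult_minus_left by linarith
      finally show ?thesis .
    qed
    let ?t = "t \<delta> n" and ?a = "a \<delta> n" and ?T = "t \<delta>' n" and ?A = "a \<delta>' n"
    let ?small = "\<lambda>F. \<forall>C\<in>components n F. card C < ?A"
    let ?two = "\<lambda>F. \<exists>C\<in>components n F. \<exists>C'\<in>components n F. C \<noteq> C' \<and> ?t < card C \<and> ?t < card C'"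
    let ?\<Phi> = "\<lambda>F. \<exists>K. unique_giant c n F K \<and> \<epsilon>\<^sup>2 / 2048 * real n \<le> real (card K)"
    have small: "(\<Sum>F\<in>Pow (pairs n). m F * of_bool (?small F)) \<le> exp (- \<gamma> * (\<delta>' * real n / 2))"
    proof -
      have "real ?T \<le> \<epsilon> / 64 * n" using t64 \<delta>' by simp
      moreover have "\<epsilon> * real n \<le> 1 * real n" using \<epsilon> by (intro mult_right_mono) auto
      ultimately have T: "?T \<le> n" by simp
      have "real ?T * n \<le> \<epsilon> / 64 * n * n" using \<open>real ?T \<le> _\<close> by (intro mult_right_mono) auto
      also have "\<dots> \<le> 3 * (\<epsilon> / 128 * real n) * real n" using \<epsilon> by simp
      finally have "real (?T * n) \<le> real K" using K3 by simp
      then have "?T * n \<le> K" by (simp only: of_nat_le_iff)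
      then have "(\<Sum>F\<in>Pow (pairs n). m F * of_bool (?small F)) \<le> r ^ (?T * (n - (?T + ?A))) / w ^ (?A + ?T)"
        using w r T n graph_prob_nonneg sum_graph_prob tilt[of w]
        by (intro no_large_component_bound[where K = K]) (auto simp: r_def)
      also have "\<dots> \<le> r ^ (?T * (n - (2 * ?T + ?A))) / w ^ (?A + ?T)"
        using r w by (intro divide_right_mono power_decreasing mult_le_mono) auto
      also have "\<dots> \<le> exp (- \<gamma> * (\<delta>' * real n / 2))" using decay[of \<delta>'] \<delta>' elim by simp
      finally show ?thesis .
    qed
    have two: "(\<Sum>F\<in>Pow (pairs n). m F * of_bool (?two F))
      \<le> real n ^ 2 * (2 * exp (- \<gamma> * (\<delta> * real n / 2)) + exp (- ((\<epsilon> * \<delta> / 32)\<^sup>2 * real n)))"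
    proof -
      have t: "real ?t \<le> \<epsilon> / 128 * n"
        using t_le[OF \<delta>(1), of n] mult_right_mono[OF \<delta>(2), of "real n"] by simp
      moreover have "\<epsilon> * real n \<le> 1 * real n" using \<epsilon> by (intro mult_right_mono) auto
      ultimately have t2: "2 * ?t \<le> n" by simp
      have "real ?a * real ?a \<le> real ?t * real n"
        using a_t[of \<delta>] t2 by (intro mult_mono) auto
      moreover have "3 * real ?t * real n \<le> 3 * (\<epsilon> / 128 * n) * real n"
        using t by (intro mult_right_mono mult_left_mono) auto
      ultimately have "real (2 * ?t * n + ?a * ?a) \<le> real K" using K3 by (simp add: algebra_simps)
      then have "2 * ?t * n + ?a * ?a \<le> K" by (simp only: of_nat_le_iff)
      then have "(\<Sum>F\<in>Pow (pairs n). m F * of_bool (?two F))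
        \<le> real n ^ 2 * (2 * (r ^ (?t * (n - (2 * ?t + ?a))) / w ^ (?a + ?t)) + (1 - q) ^ (?a * ?a))"
        using w r q t2 n graph_prob_nonneg sum_graph_prob tilt[of w] tilt0
        by (intro two_large_components_bound[where K = K]) (auto simp: r_def)
      also have "\<dots> \<le> real n ^ 2 * (2 * exp (- \<gamma> * (\<delta> * real n / 2)) + exp (- ((\<epsilon> * \<delta> / 32)\<^sup>2 * real n)))"
      proof (intro mult_left_mono add_mono)
        show "r ^ (?t * (n - (2 * ?t + ?a))) / w ^ (?a + ?t) \<le> exp (- \<gamma> * (\<delta> * real n / 2))"
          using decay[of \<delta>] \<delta> \<epsilon> elim by simp
        have "(\<epsilon> * \<delta> / 32 * n)\<^sup>2 \<le> (real ?a)\<^sup>2" using elim(3) \<epsilon>\<delta> by (intro power_mono) auto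
        then have "(\<epsilon> * \<delta> / 32)\<^sup>2 * real n \<le> real (?a * ?a) * (1 / n)"
          using n by (simp add: field_simps power2_eq_square)
        also have "\<dots> \<le> real (?a * ?a) * q"
          using \<epsilon> n by (intro mult_left_mono) (auto simp: q_def divide_right_mono)
        finally have *: "(\<epsilon> * \<delta> / 32)\<^sup>2 * real n \<le> real (?a * ?a) * q" .
        have "(1 - q) ^ (?a * ?a) \<le> exp (- q) ^ (?a * ?a)"
          using exp_ge_add_one_self[of "- q"] q by (intro power_mono) auto
        also have "\<dots> = exp (- (real (?a * ?a) * q))" by (simp add: exp_of_nat_mult[symmetric])
        also have "\<dots> \<le> exp (- ((\<epsilon> * \<delta> / 32)\<^sup>2 * real n))" using * by simp
        finally show "(1 - q) ^ (?a * ?a) \<le> exp (- ((\<epsilon> * \<delta> / 32)\<^sup>2 * real n))" .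
      qed auto
      finally show ?thesis .
    qed
    \<comment> \<open>The giant is any component with at least \<open>?A\<close> vertices; a second
      component above \<open>c * n\<close> would put \<open>F\<close> in the event
      \<open>?two\<close>.\<close>
    have good: "?\<Phi> F" if nsmall: "\<not> ?small F" and ntwo: "\<not> ?two F" for F
    proof -
      obtain C where C: "C \<in> components n F" "?A \<le> card C" using nsmall by (auto simp: not_less)
      have large: "\<epsilon>\<^sup>2 / 2048 * real n \<le> real (card C)" using elim(4) C(2) by simp
      have cn: "c * real n \<le> real (card C)"
        using mult_right_mono[OF c(2), of "real n"] large by simp
      have "real ?t < c * real n" using t_le[OF \<delta>(1), of n] mult_pos_pos[OF c(1) n(3)] by (simp add: \<delta>_def)
      then have "?t < card L" if "c * real n \<le> real (card L)" for L :: "nat set" using that by linarith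
      then have "L = C" if "L \<in> components n F" "c * real n \<le> real (card L)" for L
        using that C(1) cn ntwo by blast
      then show ?thesis using C(1) cn large unfolding unique_giant_def by blast
    qed
    have "(\<Sum>F\<in>Pow (pairs n). m F * of_bool (\<not> ?\<Phi> F))
      \<le> (\<Sum>F\<in>Pow (pairs n). m F * of_bool (?small F) + m F * of_bool (?two F))"
    proof (intro sum_mono)
      fix F
      have "of_bool (\<not> ?\<Phi> F) \<le> (of_bool (?small F) + of_bool (?two F) :: real)"
        using good[of F] by (cases "?small F"; cases "?two F"; cases "?\<Phi> F") simp_all
      then show "m F * of_bool (\<not> ?\<Phi> F) \<le> m F * of_bool (?small F) + m F * of_bool (?two F)"
        using mult_left_mono[OF _ graph_prob_nonneg] by (simp only: distrib_left[symmetric])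
    qed
    also have "\<dots> \<le> b n" using small two unfolding sum.distrib b_def by linarith
    finally show ?case by (rule prob_graph_ge)
  qed
qed

theorem theorem2p7:
  fixes \<epsilon> :: real
  assumes "0 < \<epsilon>" and "\<epsilon> < 1"
  shows
    "(\<exists>C::real. \<forall>(M :: nat \<Rightarrow> real) (\<alpha> :: nat \<Rightarrow> nat set \<Rightarrow> real) (p :: nat \<Rightarrow> real).
        (\<forall>n. M_bounded n (M n) (\<alpha> n)) \<longrightarrow>
        (\<forall>n\<ge>1. p n \<le> (1 - \<epsilon>) / (M n * real n)) \<longrightarrow>
        whp (\<lambda>n. unif_simplex n (\<alpha> n))
          (\<lambda>n X. real (max_component_size n (threshold_graph n (p n) X)) \<le> C * ln (real n)))
     \<and>
     (\<exists>\<kappa> :: real \<Rightarrow> real. (\<forall>m\<ge>1. 0 < \<kappa> m) \<and>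
        (\<forall>(M :: nat \<Rightarrow> real) (\<alpha> :: nat \<Rightarrow> nat set \<Rightarrow> real) (p :: nat \<Rightarrow> real).
          (\<forall>n. M_bounded n (M n) (\<alpha> n)) \<longrightarrow>
          (\<forall>n\<ge>1. (1 + \<epsilon>) * M n / real n \<le> p n) \<longrightarrow>
          (\<exists>c\<^sub>0>0. \<forall>c. 0 < c \<and> c \<le> c\<^sub>0 \<longrightarrow>
            whp (\<lambda>n. unif_simplex n (\<alpha> n))
              (\<lambda>n X. \<exists>K. unique_giant c n (threshold_graph n (p n) X) K \<and>
                         \<kappa> (M n) * real n \<le> real (card K)))))"
proof (rule conjI)
  show "\<exists>C::real. \<forall>(M :: nat \<Rightarrow> real) (\<alpha> :: nat \<Rightarrow> nat set \<Rightarrow> real) (p :: nat \<Rightarrow> real).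
        (\<forall>n. M_bounded n (M n) (\<alpha> n)) \<longrightarrow>
        (\<forall>n\<ge>1. p n \<le> (1 - \<epsilon>) / (M n * real n)) \<longrightarrow>
        whp (\<lambda>n. unif_simplex n (\<alpha> n))
          (\<lambda>n X. real (max_component_size n (threshold_graph n (p n) X)) \<le> C * ln (real n))"
    using subcritical_whp[OF assms] by blast
  \<comment> \<open>A constant function serves as \<open>\<kappa>\<close>, because \<open>M\<close>
    has cancelled in the bound on the edge probabilities. The same number bounds the admissible
    thresholds \<open>c\<close>, so that the component found always exceeds
    \<open>c * n\<close>.\<close>
  have "0 < \<epsilon>\<^sup>2 / 2048" using assms by simp
  then show "\<exists>\<kappa> :: real \<Rightarrow> real. (\<forall>m\<ge>1. 0 < \<kappa> m) \<and>
        (\<forall>(M :: nat \<Rightarrow> real) (\<alpha> :: nat \<Rightarrow> nat set \<Rightarrow> real) (p :: nat \<Rightarrow> real).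
          (\<forall>n. M_bounded n (M n) (\<alpha> n)) \<longrightarrow>
          (\<forall>n\<ge>1. (1 + \<epsilon>) * M n / real n \<le> p n) \<longrightarrow>
          (\<exists>c\<^sub>0>0. \<forall>c. 0 < c \<and> c \<le> c\<^sub>0 \<longrightarrow>
            whp (\<lambda>n. unif_simplex n (\<alpha> n))
              (\<lambda>n X. \<exists>K. unique_giant c n (threshold_graph n (p n) X) K \<and>
                         \<kappa> (M n) * real n \<le> real (card K))))"
    using supercritical_whp[OF assms]
    by (intro exI[of _ "\<lambda>_. \<epsilon>\<^sup>2 / 2048"] conjI allI impI exI[of _ "\<epsilon>\<^sup>2 / 2048"]) auto
qed

end
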